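(* Let $d_1,d_2\ge1$ be integers and let $\boldsymbol\kappa=(\kappa_1,\dots,\kappa_{d_2})\in\mathbb{R}^{d_2}$ with $\kappa_i>-1$ for $1\le i\le d_2$. Define the fourth-order differential operator $$ \begin{aligned} \mathfrak{D}_{\boldsymbol\kappa}^{\mathbb{R}\rtimes\Sigma}u:={}&-\tfrac14|y|^3\Delta_x^2u+|y|\langle x,\nabla_x\rangle\Delta_xu+\Big(1+\tfrac12(\kappa_{d_2}+d_1)\Big)|y|\Delta_xu\\ &+2\langle x,\nabla_x\rangle\partial_{y_{d_2}}u-2\langle y,\nabla_y\rangle\partial_{y_{d_2}}u+\sum_{i=1}^{d_2}\big[y_i\partial_{y_i}^2+(\kappa_i+1-y_i)\partial_{y_i}\big]u\\ &+2|y|\partial_{y_{d_2}}^2u-\langle x,\nabla_x\rangle u-(|\boldsymbol\kappa'|-d_1+d_2-1)\partial_{y_{d_2}}u , \end{aligned} $$ where $|\boldsymbol\kappa'|=\kappa_1+\dots+\kappa_{d_2-1}$. Then, for each $n\in\mathbb{N}_0$, $\mathcal{V}_n\big(\mathbb{R}^{d_1}\rtimes\mathbb{R}_\Sigma^{d_2},W_{\boldsymbol\kappa}^{\mathbb{R}\rtimes\Sigma}\big)$ is an eigenspace of $\mathfrak{D}_{\boldsymbol\kappa}^{\mathbb{R}\rtimes\Sigma}$; more precisely, $$ \mathfrak{D}_{\boldsymbol\kappa}^{\mathbb{R}\rtimes\Sigma}u=-n\,u\qquad\text{for all }u\in\mathcal{V}_n\big(\mathbb{R}^{d_1}\rtimes\mathbb{R}_\Sigma^{d_2},W_{\boldsymbol\kappa}^{\mathbb{R}\rtimes\Sigma}\big).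 $$
   Context: Variables are $(x,y)\in\mathbb{R}^{d_1}\times\mathbb{R}^{d_2}$; $\|x\|$ is the Euclidean norm, $|y|=y_1+\dots+y_{d_2}$ (signed sum), $|y'|=y_1+\dots+y_{d_2-1}$; $\Delta_x$ is the Laplacian in $x$, $\langle x,\nabla_x\rangle=\sum_ix_i\partial_{x_i}$, $\langle y,\nabla_y\rangle=\sum_iy_i\partial_{y_i}$, and products of operators mean composition, so $\langle y,\nabla_y\rangle\partial_{y_{d_2}}=\sum_iy_i\partial_{y_i}\partial_{y_{d_2}}$. $\mathbb{R}_\Sigma^{d}=\{y\in\mathbb{R}^d:y_1\ge0,\dots,y_{d-1}\ge0,\ |y|\ge0\}$. The domain is $\mathbb{R}^{d_1}\rtimes\mathbb{R}_\Sigma^{d_2}=\mathbb{R}^{d_1}\times\mathbb{R}_\Sigma^{d_2}$ with weight $W_{\boldsymbol\kappa}^{\mathbb{R}\rtimes\Sigma}(x,y)=\prod_{i=1}^{d_2-1}y_i^{\kappa_i}\,|y|^{\kappa_{d_2}}e^{-|y'|-|y|}\exp\!\big(-\tfrac{\|x\|^2}{|y|^2}\big)$. For a weight $W$ on $\Omega$, $\mathcal{V}_n(\Omega,W)$ is the space of real polynomials of degree $n$ (together with $0$) orthogonal to all polynomials of degree less than $n$ with respect to $\int_\Omega fg\,W$. *)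

theory Defs
  imports "HOL-Analysis.Analysis"
begin

text \<open>
  Points are pairs \<open>(x, y)\<close> with \<open>x :: real^'m\<close> and \<open>y :: real^'n\<close>, where
  \<open>d\<^sub>1 = CARD('m)\<close> and \<open>d\<^sub>2 = CARD('n)\<close>. The coordinates of \<open>y\<close> carry no order; the
  parameter \<open>l :: 'n\<close> is the index of the coordinate written \<open>y\<^bsub>d\<^sub>2\<^esub>\<close>, and
  \<open>UNIV - {l}\<close> plays the role of \<open>{1, \<dots>, d\<^sub>2 - 1}\<close>.
\<close>

section \<open>Polynomials and orthogonality\<close>

definition monomial ::
  "('m::finite \<Rightarrow> nat) \<Rightarrow> ('n::finite \<Rightarrow> nat) \<Rightarrow> (real^'m) \<times> (real^'n) \<Rightarrow> real" where
  "monomial a b = (\<lambda>(x, y). (\<Prod>i\<in>UNIV. (x $ i) ^ a i) * (\<Prod>j\<in>UNIV. (y $ j) ^ b j))"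

text \<open>The index set of the sum is finite, since \<open>'m\<close> and \<open>'n\<close> are finite.\<close>

definition poly_deg_le ::
  "nat \<Rightarrow> ((real^'m::finite) \<times> (real^'n::finite) \<Rightarrow> real) \<Rightarrow> bool" where
  "poly_deg_le n p \<longleftrightarrow>
     (\<exists>c :: ('m \<Rightarrow> nat) \<times> ('n \<Rightarrow> nat) \<Rightarrow> real.
        \<forall>z. p z = (\<Sum>(a, b) \<in> {(a, b). sum a UNIV + sum b UNIV \<le> n}. c (a, b) * monomial a b z))"

text \<open>The zero polynomial has degree 0 in this sense.\<close>

definition poly_deg ::
  "((real^'m::finite) \<times> (real^'n::finite) \<Rightarrow> real) \<Rightarrow> nat \<Rightarrow> bool" where
  "poly_deg p n \<longleftrightarrow> poly_deg_le n p \<and> (\<forall>m<n. \<not> poly_deg_le m p)"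

definition orth_polys ::
  "nat \<Rightarrow> ((real^'m::finite) \<times> (real^'n::finite)) set \<Rightarrow> ((real^'m) \<times> (real^'n) \<Rightarrow> real) \<Rightarrow>
   ((real^'m) \<times> (real^'n) \<Rightarrow> real) set" where
  "orth_polys n \<Omega> W =
     {u. (u = (\<lambda>z. 0) \<or> poly_deg u n) \<and>
         (\<forall>m<n. \<forall>q. poly_deg q m \<longrightarrow> (LINT z:\<Omega>|lborel. u z * q z * W z) = 0)}"

section \<open>The domain and the weight\<close>

definition ysum :: "real^'n::finite \<Rightarrow> real" where
  "ysum y = (\<Sum>j\<in>UNIV. y $ j)"

definition ysum' :: "'n \<Rightarrow> real^'n::finite \<Rightarrow> real" where
  "ysum' l y = (\<Sum>j\<in>UNIV - {l}. y $ j)"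

definition R_Sigma :: "'n \<Rightarrow> (real^'n::finite) set" where
  "R_Sigma l = {y. (\<forall>j\<in>UNIV - {l}. 0 \<le> y $ j) \<and> 0 \<le> ysum y}"

definition dom_RSigma :: "'n \<Rightarrow> ((real^'m::finite) \<times> (real^'n::finite)) set" where
  "dom_RSigma l = UNIV \<times> R_Sigma l"

text \<open>
  The conventions \<open>0 powr a = 0\<close> and \<open>a / 0 = 0\<close> only affect the values where some
  \<open>y $ j = 0\<close> with \<open>j \<noteq> l\<close> or \<open>ysum y = 0\<close>, which is a null set.
\<close>

definition weight_RSigma ::
  "'n \<Rightarrow> real^'n \<Rightarrow> (real^'m::finite) \<times> (real^'n::finite) \<Rightarrow> real" where
  "weight_RSigma l \<kappa> = (\<lambda>(x, y).
     (\<Prod>j\<in>UNIV - {l}. (y $ j) powr (\<kappa> $ j)) * ysum y powr (\<kappa> $ l)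
     * exp (- ysum' l y - ysum y) * exp (- ((norm x)\<^sup>2 / (ysum y)\<^sup>2)))"

section \<open>Differential operators\<close>

definition dx ::
  "'m \<Rightarrow> ((real^'m::finite) \<times> (real^'n::finite) \<Rightarrow> real) \<Rightarrow> (real^'m) \<times> (real^'n) \<Rightarrow> real" where
  "dx i u = (\<lambda>(x, y). deriv (\<lambda>t. u (x + t *\<^sub>R axis i 1, y)) 0)"

definition dy ::
  "'n \<Rightarrow> ((real^'m::finite) \<times> (real^'n::finite) \<Rightarrow> real) \<Rightarrow> (real^'m) \<times> (real^'n) \<Rightarrow> real" where
  "dy j u = (\<lambda>(x, y). deriv (\<lambda>t. u (x, y + t *\<^sub>R axis j 1)) 0)"

definition laplace_x ::
  "((real^'m::finite) \<times> (real^'n::finite) \<Rightarrow> real) \<Rightarrow> (real^'m) \<times> (real^'n) \<Rightarrow> real" where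
  "laplace_x u z = (\<Sum>i\<in>UNIV. dx i (dx i u) z)"

definition euler_x ::
  "((real^'m::finite) \<times> (real^'n::finite) \<Rightarrow> real) \<Rightarrow> (real^'m) \<times> (real^'n) \<Rightarrow> real" where
  "euler_x u z = (\<Sum>i\<in>UNIV. fst z $ i * dx i u z)"

definition euler_y ::
  "((real^'m::finite) \<times> (real^'n::finite) \<Rightarrow> real) \<Rightarrow> (real^'m) \<times> (real^'n) \<Rightarrow> real" where
  "euler_y u z = (\<Sum>j\<in>UNIV. snd z $ j * dy j u z)"

definition D_RSigma ::
  "'n \<Rightarrow> real^'n \<Rightarrow> ((real^'m::finite) \<times> (real^'n::finite) \<Rightarrow> real) \<Rightarrow>
   (real^'m) \<times> (real^'n) \<Rightarrow> real" where
  "D_RSigma l \<kappa> u = (\<lambda>(x, y).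
     - (1/4) * ysum y ^ 3 * laplace_x (laplace_x u) (x, y)
     + ysum y * euler_x (laplace_x u) (x, y)
     + (1 + (1/2) * (\<kappa> $ l + real CARD('m))) * ysum y * laplace_x u (x, y)
     + 2 * euler_x (dy l u) (x, y)
     - 2 * euler_y (dy l u) (x, y)
     + (\<Sum>j\<in>UNIV. y $ j * dy j (dy j u) (x, y) + (\<kappa> $ j + 1 - y $ j) * dy j u (x, y))
     + 2 * ysum y * dy l (dy l u) (x, y)
     - euler_x u (x, y)
     - (ysum' l \<kappa> - real CARD('m) + real CARD('n) - 1) * dy l u (x, y))"

end

theory Submission
  imports Defs "HOL-Probability.Distributions"
begin

text \<open>
  The operator \<open>D\<close> is symmetric for the weight \<open>W\<close>, and \<open>D u + n u\<close> has degree less than \<open>n\<close> whenever \<open>u\<close> has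
  degree at most \<open>n\<close> (\<open>degree_le_D_RSigma_plus\<close>). If \<open>u\<close> is also orthogonal to all polynomials of lower degree, then
  \<open>p = D u + n u\<close> and \<open>D p\<close> are both of lower degree, so that
  \<open>\<integral> p\<^sup>2 W = \<integral> (D u) p W + n \<integral> u p W = \<integral> u (D p) W + n \<integral> u p W = 0\<close> and hence \<open>p = 0\<close>.

  The substance is the symmetry. Put \<open>t = |y|\<close> and \<open>\<alpha> = \<kappa>\<^sub>l + d\<^sub>1\<close>, where \<open>l\<close> is the index of the distinguished
  coordinate, and use the coordinates \<open>x\<close>, \<open>t\<close> and \<open>y\<^sub>j\<close> for \<open>j \<noteq> l\<close>. With \<open>s = x / t\<close> the weight becomes a product of
  a Gaussian in \<open>s\<close> and Gamma densities in \<open>t\<close> and the \<open>y\<^sub>j\<close>. Let \<open>T\<close> be the operator \<open>t \<partial>\<^sub>t\<close> at fixed \<open>s\<close>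
  (\<open>cone_dil\<close>), \<open>H\<close> the Hermite operator in \<open>s\<close> (\<open>hermite_op\<close>), and \<open>\<partial>'\<^sub>j = \<partial>\<^sub>j - \<partial>\<^sub>l\<close> the derivative in \<open>y\<^sub>j\<close> at
  fixed \<open>t\<close> (\<open>shear_deriv\<close>). Then, by \<open>D_RSigma_factorisation\<close>,
  \<open>t D = T\<^sup>2 + (\<alpha> - t) T - H\<^sup>2 + \<alpha> H + t \<Sum>\<^bsub>j \<noteq> l\<^esub> (y\<^sub>j \<partial>'\<^sub>j\<^sup>2 + (\<kappa>\<^sub>j + 1 - y\<^sub>j) \<partial>'\<^sub>j)\<close>.

  Because of the factor \<open>t\<close> the natural functional is \<open>J f = \<integral> f W / t\<close>. It is finite on polynomials, as the
  substitution \<open>x = t s\<close> raises the exponent of \<open>t\<close> to \<open>\<alpha> - 1 > -1\<close>. For each of \<open>T\<close>, \<open>\<partial>\<^sub>x\<close> and \<open>\<partial>'\<^sub>j\<close> there is an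
  integration by parts formula for \<open>J\<close> with polynomial coefficients (\<open>J_cone_dil\<close>, \<open>J_dx\<close>, \<open>J_shear_deriv\<close>). Instead of boundary
  terms, one compares moments: all three operators act simply on monomials in \<open>x\<close>, \<open>t\<close> and the \<open>y\<^sub>j\<close>, and on those
  \<open>J\<close> is a product of Gaussian moments and Gamma values, so that the formulas reduce to the recursions of these
  numbers. They turn \<open>J (v t D u)\<close> into a form symmetric in \<open>u\<close> and \<open>v\<close> (\<open>J_D_RSigma_parts\<close>).
\<close>

section \<open>Polynomials and their degree\<close>

type_synonym ('m, 'n) point = "(real^'m) \<times> (real^'n)"

definition coords :: "(('m::finite, 'n::finite) point \<Rightarrow> real) set" where
  "coords = range (\<lambda>i z. fst z $ i) \<union> range (\<lambda>j z. snd z $ j)"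

lemma coords_fst: "(\<lambda>z. fst z $ i) \<in> coords" and coords_snd: "(\<lambda>z. snd z $ j) \<in> coords"
  by (auto simp: coords_def)

lemma coords_cases:
  assumes "\<xi> \<in> coords"
  obtains i where "\<xi> = (\<lambda>z. fst z $ i)" | j where "\<xi> = (\<lambda>z. snd z $ j)"
  using assms by (auto simp: coords_def)

lemma coord_linear: "\<xi> \<in> coords \<Longrightarrow> linear \<xi>"
  by (auto simp: coords_def linear_iff)

text \<open>
  A coordinatewise generated form of \<open>poly_deg_le\<close>. The degree bound is an integer so that differentiation
  lowers it by exactly one at every bound; for negative bounds only the zero function remains (\<open>degree_le_neg\<close>).
\<close>

inductive degree_le :: "int \<Rightarrow> (('m::finite, 'n::finite) point \<Rightarrow> real) \<Rightarrow> bool" where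
  const: "0 \<le> k \<or> c = 0 \<Longrightarrow> degree_le k (\<lambda>z. c)"
| coord: "degree_le (k - 1) f \<Longrightarrow> \<xi> \<in> coords \<Longrightarrow> degree_le k (\<lambda>z. \<xi> z * f z)"
| add: "degree_le k f \<Longrightarrow> degree_le k g \<Longrightarrow> degree_le k (\<lambda>z. f z + g z)"

lemma degree_le_neg: "degree_le k f \<Longrightarrow> k < 0 \<Longrightarrow> f = (\<lambda>z. 0)"
  by (induction rule: degree_le.induct) auto

lemma degree_le_mono: "degree_le k f \<Longrightarrow> k \<le> k' \<Longrightarrow> degree_le k' f"
proof (induction arbitrary: k' rule: degree_le.induct)
  case (const k c)
  then show ?case by (intro degree_le.const) auto
next
  case (coord k f \<xi>)
  show ?case by (rule degree_le.coord) (use coord in auto)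
next
  case (add k f g)
  then show ?case by (intro degree_le.add) auto
qed

lemma degree_le_scale: "degree_le k f \<Longrightarrow> degree_le k (\<lambda>z. c * f z)"
proof (induction rule: degree_le.induct)
  case (const k c')
  then show ?case by (intro degree_le.const) auto
next
  case (coord k f \<xi>)
  have "degree_le k (\<lambda>z. \<xi> z * (c * f z))"
    by (rule degree_le.coord) (use coord in auto)
  then show ?case by (simp add: mult_ac)
next
  case (add k f g)
  have "degree_le k (\<lambda>z. c * f z + c * g z)" by (rule degree_le.add) (use add in auto)
  then show ?case by (simp add: algebra_simps)
qed

lemma degree_le_zero: "degree_le k (\<lambda>z. 0)" by (rule degree_le.const) simp

lemma degree_le_diff: "degree_le k f \<Longrightarrow> degree_le k g \<Longrightarrow> degree_le k (\<lambda>z. f z - g z)"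
  using degree_le.add[of k f "\<lambda>z. (-1) * g z"] degree_le_scale[of k g "-1"] by simp

lemma degree_le_sum: "(\<And>i. i \<in> I \<Longrightarrow> degree_le k (f i)) \<Longrightarrow> degree_le k (\<lambda>z. \<Sum>i\<in>I. f i z)"
proof (induction I rule: infinite_finite_induct)
  case (insert i I)
  then show ?case using degree_le.add[of k "f i" "\<lambda>z. \<Sum>i\<in>I. f i z"] by simp
qed (simp_all add: degree_le_zero)

lemma degree_le_mult: "degree_le j f \<Longrightarrow> degree_le k g \<Longrightarrow> degree_le (j + k) (\<lambda>z. f z * g z)"
proof (induction rule: degree_le.induct)
  case (const j c)
  show ?case
  proof (cases "c = 0")
    case True then show ?thesis by (simp add: degree_le_zero)
  next
    case False
    then show ?thesis using const degree_le_scale[OF degree_le_mono[OF const.prems, of "j + k"]] by simp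
  qed
next
  case (coord j f \<xi>)
  have "degree_le (j + k) (\<lambda>z. \<xi> z * (f z * g z))"
    by (rule degree_le.coord) (use coord in \<open>auto simp: algebra_simps\<close>)
  then show ?case by (simp add: mult_ac)
next
  case (add j f h)
  have "degree_le (j + k) (\<lambda>z. f z * g z + h z * g z)" by (rule degree_le.add) (use add in auto)
  then show ?case by (simp add: algebra_simps)
qed

lemma degree_le_power: "degree_le 1 f \<Longrightarrow> degree_le (int k) (\<lambda>z. f z ^ k)"
proof (induction k)
  case (Suc k)
  then show ?case using degree_le_mult[of 1 f "int k" "\<lambda>z. f z ^ k"] by (simp add: add.commute)
qed (auto intro: degree_le.const)

lemma degree_le_prod: "(\<And>i. i \<in> I \<Longrightarrow> degree_le (int (d i)) (f i)) \<Longrightarrow> degree_le (int (sum d I)) (\<lambda>z. \<Prod>i\<in>I. f i z)"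
proof (induction I rule: infinite_finite_induct)
  case (insert i I)
  then show ?case using degree_le_mult[of "int (d i)" "f i" "int (sum d I)" "\<lambda>z. \<Prod>i\<in>I. f i z"] by simp
qed (auto intro: degree_le.const)

lemma degree_le_coord: "\<xi> \<in> coords \<Longrightarrow> degree_le 1 \<xi>"
  using degree_le.coord[of 1 "\<lambda>z. 1" \<xi>] by (simp add: degree_le.const)

lemma degree_le_monomial: "degree_le (int (sum a UNIV + sum b UNIV)) (monomial a b)"
  unfolding monomial_def case_prod_beta' of_nat_add
  by (intro degree_le_mult degree_le_prod degree_le_power degree_le_coord coords_fst coords_snd)

lemma poly_deg_le_imp_degree_le: "poly_deg_le n f \<Longrightarrow> degree_le (int n) f"
proof -
  assume "poly_deg_le n f"
  then obtain c where f: "f = (\<lambda>z. \<Sum>(a, b) \<in> {(a, b). sum a UNIV + sum b UNIV \<le> n}. c (a, b) * monomial a b z)"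
    unfolding poly_deg_le_def by blast
  show ?thesis unfolding f case_prod_beta'
    by (intro degree_le_sum degree_le_scale degree_le_mono[OF degree_le_monomial]) (auto simp del: of_nat_add of_nat_sum)
qed

lemma finite_exponents: "finite {(a :: 'm::finite \<Rightarrow> nat, b :: 'n::finite \<Rightarrow> nat). sum a UNIV + sum b UNIV \<le> n}"
proof (rule finite_subset)
  show "{(a :: 'm \<Rightarrow> nat, b :: 'n \<Rightarrow> nat). sum a UNIV + sum b UNIV \<le> n}
      \<subseteq> (UNIV \<rightarrow>\<^sub>E {..n}) \<times> (UNIV \<rightarrow>\<^sub>E {..n})"
  proof (rule subsetI)
    fix s assume "s \<in> {(a :: 'm \<Rightarrow> nat, b :: 'n \<Rightarrow> nat). sum a UNIV + sum b UNIV \<le> n}"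
    then obtain a b where s: "s = (a, b)" and *: "sum a UNIV + sum b UNIV \<le> n" by blast
    have "a i \<le> n" for i using member_le_sum[of i UNIV a] * by simp
    moreover have "b i \<le> n" for i using member_le_sum[of i UNIV b] * by simp
    ultimately show "s \<in> (UNIV \<rightarrow>\<^sub>E {..n}) \<times> (UNIV \<rightarrow>\<^sub>E {..n})" by (auto simp: s)
  qed
qed (intro finite_cartesian_product finite_PiE; simp)

text \<open>
  Admits repeated exponents and a choice of index set, so that products with a coordinate and sums need
  no explicit reindexing of coefficients.
\<close>

lemma poly_deg_le_sumI:
  fixes g :: "'i \<Rightarrow> ('m::finite \<Rightarrow> nat) \<times> ('n::finite \<Rightarrow> nat)"
  assumes "finite K" and g: "\<And>k. k \<in> K \<Longrightarrow> sum (fst (g k)) UNIV + sum (snd (g k)) UNIV \<le> n"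
    and f: "\<And>z. f z = (\<Sum>k\<in>K. c k * monomial (fst (g k)) (snd (g k)) z)"
  shows "poly_deg_le n f"
proof -
  let ?S = "{(a :: 'm \<Rightarrow> nat, b :: 'n \<Rightarrow> nat). sum a UNIV + sum b UNIV \<le> n}"
  have "f z = (\<Sum>s\<in>?S. (\<Sum>k\<in>{k \<in> K. g k = s}. c k) * monomial (fst s) (snd s) z)" for z
  proof -
    have "(\<Sum>k\<in>K. c k * monomial (fst (g k)) (snd (g k)) z)
        = (\<Sum>s\<in>?S. \<Sum>k\<in>{k \<in> K. g k = s}. c k * monomial (fst (g k)) (snd (g k)) z)"
      using g by (intro sum.group[symmetric] assms finite_exponents) (auto simp: case_prod_beta')
    then show ?thesis unfolding f by (simp add: sum_distrib_right)
  qed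
  then show ?thesis unfolding poly_deg_le_def
    by (intro exI[of _ "\<lambda>s. \<Sum>k\<in>{k \<in> K. g k = s}. c k"]) (simp add: case_prod_beta')
qed

lemma prod_change_one:
  fixes g g' :: "'i::finite \<Rightarrow> 'c::comm_monoid_mult"
  assumes "g' j = c * g j" and "\<And>i. i \<noteq> j \<Longrightarrow> g' i = g i"
  shows "prod g' UNIV = c * prod g UNIV"
  using assms by (simp add: prod.remove[of UNIV j] mult.assoc)

lemma monomial_mult_fst: "fst z $ i * monomial a b z = monomial (a(i := Suc (a i))) b z"
  unfolding monomial_def case_prod_beta' mult.assoc[symmetric]
  by (rule arg_cong2[of _ _ _ _ "(*)"], rule prod_change_one[symmetric]) auto

lemma monomial_mult_snd: "snd z $ j * monomial a b z = monomial a (b(j := Suc (b j))) z"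
  unfolding monomial_def case_prod_beta' mult.left_commute[of "snd z $ j"]
  by (rule arg_cong2[of _ _ _ _ "(*)"], rule refl, rule prod_change_one[symmetric]) auto

lemma sum_fun_upd_Suc: "sum (a(i := Suc (a i))) (UNIV :: 'i::finite set) = Suc (sum a UNIV)"
  by (subst (1 2) sum.remove[of _ i]) auto

lemma degree_le_imp_poly_deg_le: "degree_le k f \<Longrightarrow> k = int n \<Longrightarrow> poly_deg_le n f"
proof (induction arbitrary: n rule: degree_le.induct)
  case (const k c)
  show ?case
    by (rule poly_deg_le_sumI[of "{()}" "\<lambda>_. (\<lambda>_. 0, \<lambda>_. 0)" _ _ "\<lambda>_. c"]) (auto simp: monomial_def)
next
  case (coord k f \<xi>)
  show ?case
  proof (cases n)
    case 0
    then have "f = (\<lambda>z. 0)" using degree_le_neg[OF coord.hyps(1)] coord.prems by simp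
    then show ?thesis
      using poly_deg_le_sumI[of "{}" "\<lambda>_::unit. undefined" n "\<lambda>z. \<xi> z * f z"] by simp
  next
    case (Suc m)
    let ?S = "{(a :: 'a \<Rightarrow> nat, b :: 'b \<Rightarrow> nat). sum a UNIV + sum b UNIV \<le> m}"
    have "poly_deg_le m f" using coord Suc by simp
    then obtain c where f: "\<And>z. f z = (\<Sum>s \<in> ?S. c s * monomial (fst s) (snd s) z)"
      unfolding poly_deg_le_def by (auto simp: case_prod_beta')
    from coord.hyps(2) show ?thesis
    proof (cases rule: coords_cases)
      case (1 i)
      show ?thesis unfolding 1
        by (rule poly_deg_le_sumI[where K = ?S and g = "\<lambda>(a, b). (a(i := Suc (a i)), b)" and c = c])
           (auto simp: f sum_distrib_left monomial_mult_fst[symmetric] case_prod_beta' finite_exponents[unfolded case_prod_beta']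
              sum_fun_upd_Suc Suc mult.left_commute simp del: fun_upd_apply)
    next
      case (2 j)
      show ?thesis unfolding 2
        by (rule poly_deg_le_sumI[where K = ?S and g = "\<lambda>(a, b). (a, b(j := Suc (b j)))" and c = c])
           (auto simp: f sum_distrib_left monomial_mult_snd[symmetric] case_prod_beta' finite_exponents[unfolded case_prod_beta']
              sum_fun_upd_Suc Suc mult.left_commute simp del: fun_upd_apply)
    qed
  qed
next
  case (add k f g)
  let ?S = "{(a :: 'a \<Rightarrow> nat, b :: 'b \<Rightarrow> nat). sum a UNIV + sum b UNIV \<le> n}"
  obtain c where f: "\<And>z. f z = (\<Sum>s \<in> ?S. c s * monomial (fst s) (snd s) z)"
    using add unfolding poly_deg_le_def by (auto simp: case_prod_beta')
  obtain d where g: "\<And>z. g z = (\<Sum>s \<in> ?S. d s * monomial (fst s) (snd s) z)"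
    using add unfolding poly_deg_le_def by (auto simp: case_prod_beta')
  show ?case
    by (rule poly_deg_le_sumI[where K = ?S and g = "\<lambda>s. s" and c = "\<lambda>s. c s + d s"])
       (auto simp: f g finite_exponents sum.distrib distrib_right)
qed

definition polys :: "(('m::finite, 'n::finite) point \<Rightarrow> real) set" where
  "polys = {f. \<exists>k. degree_le k f}"

lemma degree_le_polys: "degree_le k f \<Longrightarrow> f \<in> polys" by (auto simp: polys_def)

lemma polys_const: "(\<lambda>z. c) \<in> polys" by (rule degree_le_polys[OF degree_le.const[of 0]]) simp

lemma polys_coord: "\<xi> \<in> coords \<Longrightarrow> \<xi> \<in> polys"
  using degree_le_polys[OF degree_le.coord[OF degree_le.const[of "1 - 1" 1], of \<xi>]] by simp

lemma polys_fst: "(\<lambda>z. fst z $ i) \<in> polys" and polys_snd: "(\<lambda>z. snd z $ j) \<in> polys"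
  by (auto intro!: polys_coord simp: coords_def)

lemma polys_add: "f \<in> polys \<Longrightarrow> g \<in> polys \<Longrightarrow> (\<lambda>z. f z + g z) \<in> polys"
proof -
  assume "f \<in> polys" "g \<in> polys"
  then obtain j k where "degree_le j f" "degree_le k g" by (auto simp: polys_def)
  then have "degree_le (max j k) f" "degree_le (max j k) g" by (auto intro: degree_le_mono)
  then show ?thesis by (intro degree_le_polys degree_le.add)
qed

lemma polys_mult: "f \<in> polys \<Longrightarrow> g \<in> polys \<Longrightarrow> (\<lambda>z. f z * g z) \<in> polys"
  using degree_le_mult degree_le_polys unfolding polys_def by blast

lemma polys_scale: "f \<in> polys \<Longrightarrow> (\<lambda>z. c * f z) \<in> polys"
  by (intro polys_mult polys_const)

lemma polys_diff: "f \<in> polys \<Longrightarrow> g \<in> polys \<Longrightarrow> (\<lambda>z. f z - g z) \<in> polys"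
  using polys_add[of f "\<lambda>z. (-1) * g z"] polys_scale[of g "-1"] by simp

lemma polys_sum: "(\<And>i. i \<in> I \<Longrightarrow> f i \<in> polys) \<Longrightarrow> (\<lambda>z. \<Sum>i\<in>I. f i z) \<in> polys"
  by (induction I rule: infinite_finite_induct) (auto simp: polys_const polys_add)

lemma polys_power: "f \<in> polys \<Longrightarrow> (\<lambda>z. f z ^ k) \<in> polys"
  by (induction k) (auto simp: polys_const polys_mult)

lemma polys_prod: "(\<And>i. i \<in> I \<Longrightarrow> f i \<in> polys) \<Longrightarrow> (\<lambda>z. \<Prod>i\<in>I. f i z) \<in> polys"
  by (induction I rule: infinite_finite_induct) (auto simp: polys_const polys_mult)

lemma polys_ysum: "(\<lambda>z. ysum (snd z)) \<in> polys"
  unfolding ysum_def by (intro polys_sum polys_snd)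

lemmas polys_intros = polys_const polys_fst polys_snd polys_ysum polys_add polys_mult polys_diff polys_sum
  polys_power polys_prod

lemma polys_induct [consumes 1, case_names const coord add]:
  assumes "f \<in> polys"
    and "\<And>c. P (\<lambda>z. c)"
    and "\<And>f \<xi>. f \<in> polys \<Longrightarrow> P f \<Longrightarrow> \<xi> \<in> coords \<Longrightarrow> P (\<lambda>z. \<xi> z * f z)"
    and "\<And>f g. f \<in> polys \<Longrightarrow> g \<in> polys \<Longrightarrow> P f \<Longrightarrow> P g \<Longrightarrow> P (\<lambda>z. f z + g z)"
  shows "P f"
proof -
  obtain k where "degree_le k f" using assms(1) by (auto simp: polys_def)
  then show ?thesis
    by (induction rule: degree_le.induct) (auto intro: assms degree_le_polys)
qed

lemma polys_continuous: "f \<in> polys \<Longrightarrow> continuous_on UNIV f"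
  by (induction rule: polys_induct) (auto elim!: coords_cases intro!: continuous_intros)

lemma polys_line_poly: "f \<in> polys \<Longrightarrow> \<exists>q. \<forall>s. f (z + s *\<^sub>R v) = poly q s"
proof (induction rule: polys_induct)
  case (const c)
  show ?case by (rule exI[of _ "[:c:]"]) simp
next
  case (coord f \<xi>)
  then obtain q where q: "\<forall>s. f (z + s *\<^sub>R v) = poly q s" by blast
  have "\<xi> (z + s *\<^sub>R v) = poly [:\<xi> z, \<xi> v:] s" for s
    using coord_linear[OF coord.hyps(2)] by (simp add: linear_add linear_cmul)
  then show ?case using q by (intro exI[of _ "[:\<xi> z, \<xi> v:] * q"]) (simp add: algebra_simps)
next
  case (add f g)
  then obtain q r where "\<forall>s. f (z + s *\<^sub>R v) = poly q s" "\<forall>s. g (z + s *\<^sub>R v) = poly r s" by blast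
  then show ?case by (intro exI[of _ "q + r"]) simp
qed

lemma polys_eq_0_if_open:
  assumes f: "f \<in> polys" and S: "open S" "z0 \<in> S" and 0: "\<And>z. z \<in> S \<Longrightarrow> f z = 0"
  shows "f = (\<lambda>z. 0)"
proof
  fix w
  \<comment> \<open>Along the segment from \<open>z0\<close> to \<open>w\<close> the function is a polynomial with infinitely many zeros.\<close>
  obtain q where q: "\<And>s. f (z0 + s *\<^sub>R (w - z0)) = poly q s"
    using polys_line_poly[OF f] by meson
  have "open ((\<lambda>s::real. z0 + s *\<^sub>R (w - z0)) -` S)"
    by (intro open_vimage S continuous_intros)
  moreover have "0 \<in> (\<lambda>s::real. z0 + s *\<^sub>R (w - z0)) -` S" using S by simp
  ultimately obtain e where "e > 0" "ball 0 e \<subseteq> (\<lambda>s::real. z0 + s *\<^sub>R (w - z0)) -` S"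
    by (meson openE)
  then have "ball 0 e \<subseteq> {s. poly q s = 0}" using 0 by (auto simp: subset_iff q[symmetric] simp del: split_paired_All)
  moreover have "infinite (ball (0::real) e)"
    using \<open>e > 0\<close> by (simp add: infinite_Ioo ball_eq_greaterThanLessThan)
  ultimately have "q = 0" using poly_roots_finite finite_subset by blast
  then show "f w = 0" using q[of 1] by simp
qed

section \<open>Directional derivatives\<close>

text \<open>
  A single notion covers \<open>dx\<close>, \<open>dy\<close> and the oblique directions that appear after the shear of \<open>y\<close>.
\<close>

definition dir_deriv :: "('m::finite, 'n::finite) point \<Rightarrow> (('m, 'n) point \<Rightarrow> real) \<Rightarrow> ('m, 'n) point \<Rightarrow> real" where
  "dir_deriv v f z = deriv (\<lambda>s. f (z + s *\<^sub>R v)) 0"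

lemma dx_eq_dir_deriv: "dx i = dir_deriv (axis i 1, 0)"
  by (auto simp: fun_eq_iff dx_def dir_deriv_def)

lemma dy_eq_dir_deriv: "dy j = dir_deriv (0, axis j 1)"
  by (auto simp: fun_eq_iff dy_def dir_deriv_def)

lemma polys_field_differentiable: "f \<in> polys \<Longrightarrow> (\<lambda>s. f (z + s *\<^sub>R v)) field_differentiable at (0::real)"
proof (induction rule: polys_induct)
  case (coord f \<xi>)
  have "\<xi> (z + s *\<^sub>R v) = \<xi> z + s * \<xi> v" for s
    using coord_linear[OF coord.hyps(2)] by (simp add: linear_add linear_cmul)
  then show ?case by (simp only:) (intro derivative_intros coord)
qed (intro derivative_intros; assumption)+

lemma dir_deriv_const: "dir_deriv v (\<lambda>z. c) = (\<lambda>z. 0)"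
  by (simp add: dir_deriv_def fun_eq_iff)

lemma dir_deriv_coord: "\<xi> \<in> coords \<Longrightarrow> dir_deriv v \<xi> = (\<lambda>z. \<xi> v)"
  by (rule ext) (auto simp: dir_deriv_def coords_def intro!: DERIV_imp_deriv derivative_eq_intros)

lemma dir_deriv_fst: "dir_deriv v (\<lambda>z. fst z $ i) = (\<lambda>z. fst v $ i)"
  and dir_deriv_snd: "dir_deriv v (\<lambda>z. snd z $ j) = (\<lambda>z. snd v $ j)"
  by (rule dir_deriv_coord; simp add: coords_def)+

lemma dir_deriv_add:
  assumes "f \<in> polys" "g \<in> polys"
  shows "dir_deriv v (\<lambda>z. f z + g z) = (\<lambda>z. dir_deriv v f z + dir_deriv v g z)"
  by (rule ext) (simp add: dir_deriv_def polys_field_differentiable assms)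

lemma dir_deriv_mult:
  assumes "f \<in> polys" "g \<in> polys"
  shows "dir_deriv v (\<lambda>z. f z * g z) = (\<lambda>z. dir_deriv v f z * g z + f z * dir_deriv v g z)"
  by (rule ext) (simp add: dir_deriv_def polys_field_differentiable assms)

lemma dir_deriv_scale: "f \<in> polys \<Longrightarrow> dir_deriv v (\<lambda>z. c * f z) = (\<lambda>z. c * dir_deriv v f z)"
  by (simp add: dir_deriv_mult polys_const dir_deriv_const)

lemma dir_deriv_diff: "f \<in> polys \<Longrightarrow> g \<in> polys \<Longrightarrow> dir_deriv v (\<lambda>z. f z - g z) = (\<lambda>z. dir_deriv v f z - dir_deriv v g z)"
  using dir_deriv_add[of f "\<lambda>z. (-1) * g z" v] dir_deriv_scale[of g v "-1"] polys_scale[of g "-1"] by simp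

lemma dir_deriv_sum: "(\<And>i. i \<in> I \<Longrightarrow> f i \<in> polys) \<Longrightarrow> dir_deriv v (\<lambda>z. \<Sum>i\<in>I. f i z) = (\<lambda>z. \<Sum>i\<in>I. dir_deriv v (f i) z)"
proof (induction I rule: infinite_finite_induct)
  case (insert i I)
  then show ?case using dir_deriv_add[of "f i" "\<lambda>z. \<Sum>i\<in>I. f i z" v] polys_sum[of I f] by simp
qed (simp_all add: dir_deriv_const)

lemma axis_nth: "axis i c $ k = (if k = i then c else 0)"
  by (simp add: axis_def)

lemma ysum_zero: "ysum 0 = 0"
  by (simp add: ysum_def)

lemma ysum_axis: "ysum (axis j c) = c"
proof -
  have "ysum (axis j c) = (\<Sum>i\<in>UNIV. if i = j then c else 0)"
    unfolding ysum_def by (rule sum.cong) (auto simp: axis_def)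
  then show ?thesis by simp
qed

lemma ysum_diff: "ysum (x - y) = ysum x - ysum y"
  by (simp add: ysum_def sum_subtractf)

lemma dir_deriv_ysum: "dir_deriv v (\<lambda>z. ysum (snd z)) = (\<lambda>z. ysum (snd v))"
  unfolding ysum_def by (simp add: dir_deriv_sum polys_snd dir_deriv_snd)

lemma degree_le_dir_deriv: "degree_le k f \<Longrightarrow> degree_le (k - 1) (dir_deriv v f)"
proof (induction rule: degree_le.induct)
  case (const k c)
  then show ?case by (simp add: dir_deriv_const degree_le_zero)
next
  case (coord k f \<xi>)
  have "degree_le (k - 1) (\<lambda>z. \<xi> v * f z + \<xi> z * dir_deriv v f z)"
    by (intro degree_le.add degree_le_scale degree_le.coord coord)
  then show ?case
    using coord degree_le_polys[OF coord.hyps(1)] by (simp add: dir_deriv_mult dir_deriv_coord polys_coord)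
next
  case (add k f g)
  then show ?case by (subst dir_deriv_add) (auto intro: degree_le_polys degree_le.add)
qed

lemma polys_dir_deriv: "f \<in> polys \<Longrightarrow> dir_deriv v f \<in> polys"
  using degree_le_dir_deriv degree_le_polys unfolding polys_def by blast

lemma dir_deriv_commute: "f \<in> polys \<Longrightarrow> dir_deriv v (dir_deriv w f) = dir_deriv w (dir_deriv v f)"
proof (induction rule: polys_induct)
  case (const c)
  then show ?case by (simp add: dir_deriv_const)
next
  case (coord f \<xi>)
  then show ?case
    by (simp add: dir_deriv_mult dir_deriv_add dir_deriv_const dir_deriv_coord polys_dir_deriv polys_coord polys_intros algebra_simps)
next
  case (add f g)
  then show ?case by (simp add: dir_deriv_add polys_dir_deriv)
qed

lemma dir_deriv_direction_diff: "f \<in> polys \<Longrightarrow> dir_deriv (v - w) f = (\<lambda>z. dir_deriv v f z - dir_deriv w f z)"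
proof (induction rule: polys_induct)
  case (const c)
  then show ?case by (simp add: dir_deriv_const)
next
  case (coord f \<xi>)
  have "\<xi> (v - w) = \<xi> v - \<xi> w" using coord_linear[OF coord.hyps(2)] by (simp add: linear_diff)
  then show ?case using coord by (simp add: dir_deriv_mult dir_deriv_coord polys_coord) (simp add: algebra_simps)
next
  case (add f g)
  then show ?case by (simp add: dir_deriv_add algebra_simps)
qed

section \<open>The leading part of the operator\<close>

lemma degree_le_dx: "degree_le k f \<Longrightarrow> degree_le (k - 1) (dx i f)" and degree_le_dy: "degree_le k f \<Longrightarrow> degree_le (k - 1) (dy j f)"
  by (simp_all add: dx_eq_dir_deriv dy_eq_dir_deriv degree_le_dir_deriv)

lemma degree_le_fst_mult: "degree_le (k - 1) f \<Longrightarrow> degree_le k (\<lambda>z. fst z $ i * f z)"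
  and degree_le_snd_mult: "degree_le (k - 1) f \<Longrightarrow> degree_le k (\<lambda>z. snd z $ j * f z)"
  by (auto intro: degree_le.coord coords_fst coords_snd)

lemma degree_le_laplace_x: "degree_le k f \<Longrightarrow> degree_le (k - 2) (laplace_x f)"
proof -
  assume "degree_le k f"
  then have "degree_le (k - 1 - 1) (dx i (dx i f))" for i by (intro degree_le_dx)
  then show ?thesis unfolding laplace_x_def[abs_def] by (intro degree_le_sum) simp
qed

lemma degree_le_euler_x: "degree_le k f \<Longrightarrow> degree_le k (euler_x f)" and degree_le_euler_y: "degree_le k f \<Longrightarrow> degree_le k (euler_y f)"
  unfolding euler_x_def[abs_def] euler_y_def[abs_def]
  by (intro degree_le_sum degree_le_fst_mult degree_le_dx; assumption) (intro degree_le_sum degree_le_snd_mult degree_le_dy; assumption)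

lemma degree_le_ysum_mult: "degree_le (k - 1) f \<Longrightarrow> degree_le k (\<lambda>z. ysum (snd z) * f z)"
  unfolding ysum_def sum_distrib_right by (intro degree_le_sum degree_le_snd_mult)

text \<open>
  On a homogeneous polynomial the Euler operator is multiplication by the degree; lower homogeneous parts
  of \<open>f\<close> only contribute to lower degree.
\<close>

lemma degree_le_euler_minus_degree: "degree_le k f \<Longrightarrow> degree_le (k - 1) (\<lambda>z. euler_x f z + euler_y f z - of_int k * f z)"
proof (induction rule: degree_le.induct)
  case (const k c)
  have "degree_le (k - 1) (\<lambda>z. - of_int k * c)" by (rule degree_le.const) (use const in auto)
  then show ?case by (simp add: euler_x_def euler_y_def dx_eq_dir_deriv dy_eq_dir_deriv dir_deriv_const)
next
  case (coord k f \<xi>)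
  have f: "f \<in> polys" using coord.hyps(1) by (rule degree_le_polys)
  have \<xi>: "euler_x \<xi> z + euler_y \<xi> z = \<xi> z" for z
    using coord.hyps(2)
    by (cases rule: coords_cases)
       (simp_all add: euler_x_def euler_y_def dx_eq_dir_deriv dy_eq_dir_deriv dir_deriv_fst dir_deriv_snd axis_nth if_distrib cong: if_cong)
  have "euler_x (\<lambda>z. \<xi> z * f z) z + euler_y (\<lambda>z. \<xi> z * f z) z =
      (euler_x \<xi> z + euler_y \<xi> z) * f z + \<xi> z * (euler_x f z + euler_y f z)" for z
    by (simp add: euler_x_def euler_y_def dx_eq_dir_deriv dy_eq_dir_deriv dir_deriv_mult polys_coord coord.hyps f sum.distrib
        sum_distrib_left sum_distrib_right algebra_simps)
  then have eq: "(\<lambda>z. euler_x (\<lambda>z. \<xi> z * f z) z + euler_y (\<lambda>z. \<xi> z * f z) z - of_int k * (\<xi> z * f z))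
      = (\<lambda>z. \<xi> z * (euler_x f z + euler_y f z - of_int (k - 1) * f z))"
    by (simp add: \<xi> algebra_simps)
  show ?case unfolding eq by (rule degree_le.coord[OF coord.IH coord.hyps(2)])
next
  case (add k f g)
  have "degree_le (k - 1) (\<lambda>z. (euler_x f z + euler_y f z - of_int k * f z) + (euler_x g z + euler_y g z - of_int k * g z))"
    by (rule degree_le.add) (use add in auto)
  then show ?case using degree_le_polys[OF add.hyps(1)] degree_le_polys[OF add.hyps(2)]
    by (simp add: euler_x_def euler_y_def dx_eq_dir_deriv dy_eq_dir_deriv dir_deriv_add sum.distrib algebra_simps)
qed

text \<open>
  The terms \<open>- \<langle>x, \<nabla>\<^sub>x\<rangle>\<close> and \<open>- \<Sum>\<^sub>j y\<^sub>j \<partial>\<^sub>j\<close> make up minus the Euler operator; in every other term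
  the derivatives outnumber the coordinate factors.
\<close>

lemma degree_le_D_RSigma_plus:
  fixes u :: "('m::finite, 'n::finite) point \<Rightarrow> real"
  assumes u: "degree_le k u"
  shows "degree_le (k - 1) (\<lambda>z. D_RSigma l \<kappa> u z + of_int k * u z)"
proof -
  let ?t = "\<lambda>z::('m, 'n) point. ysum (snd z)"
  have L: "degree_le (k - 2) (laplace_x u)" by (rule degree_le_laplace_x[OF u])
  have LL: "degree_le (k - 4) (laplace_x (laplace_x u))" using degree_le_laplace_x[OF L] by simp
  have Y: "degree_le (k - 1) (dy j u)" for j by (rule degree_le_dy[OF u])
  have YY: "degree_le (k - 2) (dy j (dy i u))" for i j using degree_le_dy[OF Y] by simp
  have low: "degree_le (k - 1) (\<lambda>z. - (1/4) * (?t z * (?t z * (?t z * laplace_x (laplace_x u) z)))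
     + ?t z * euler_x (laplace_x u) z
     + (1 + (1/2) * (\<kappa> $ l + real CARD('m))) * (?t z * laplace_x u z)
     + 2 * euler_x (dy l u) z
     - 2 * euler_y (dy l u) z
     + (\<Sum>j\<in>UNIV. snd z $ j * dy j (dy j u) z + (\<kappa> $ j + 1) * dy j u z)
     + 2 * (?t z * dy l (dy l u) z)
     - (ysum' l \<kappa> - real CARD('m) + real CARD('n) - 1) * dy l u z
     - (euler_x u z + euler_y u z - of_int k * u z))" (is "degree_le _ ?low")
    by (intro degree_le.add degree_le_diff degree_le_scale degree_le_sum degree_le_ysum_mult degree_le_snd_mult degree_le_euler_x degree_le_euler_y
        degree_le_euler_minus_degree u Y) (use L LL YY in simp_all)
  moreover have "?low = (\<lambda>z. D_RSigma l \<kappa> u z + of_int k * u z)"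
  proof
    fix z :: "('m, 'n) point"
    have "(\<Sum>j\<in>UNIV. snd z $ j * dy j (dy j u) z + (\<kappa> $ j + 1 - snd z $ j) * dy j u z) =
        (\<Sum>j\<in>UNIV. snd z $ j * dy j (dy j u) z + (\<kappa> $ j + 1) * dy j u z) - euler_y u z"
      unfolding euler_y_def sum_subtractf[symmetric] by (rule sum.cong) (auto simp: algebra_simps)
    then show "?low z = D_RSigma l \<kappa> u z + of_int k * u z"
      by (simp add: D_RSigma_def case_prod_beta' power3_eq_cube mult.assoc)
  qed
  ultimately show ?thesis by simp
qed

lemma degree_le_D_RSigma: "degree_le k u \<Longrightarrow> degree_le k (D_RSigma l \<kappa> u)"
  using degree_le_diff[OF degree_le_mono[OF degree_le_D_RSigma_plus, of k u k l \<kappa>] degree_le_scale, of u "of_int k"] by simp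

section \<open>Factorisation of the operator\<close>

lemma polys_dx: "f \<in> polys \<Longrightarrow> dx i f \<in> polys" and polys_dy: "f \<in> polys \<Longrightarrow> dy j f \<in> polys"
  by (simp_all add: dx_eq_dir_deriv dy_eq_dir_deriv polys_dir_deriv)

lemma polys_laplace_x: "f \<in> polys \<Longrightarrow> laplace_x f \<in> polys"
  unfolding laplace_x_def[abs_def] dx_eq_dir_deriv by (intro polys_intros polys_dir_deriv)

lemma polys_euler_x: "f \<in> polys \<Longrightarrow> euler_x f \<in> polys"
  unfolding euler_x_def[abs_def] by (intro polys_intros polys_dx)

lemma polys_half_square: "(\<lambda>z. (ysum (snd z))\<^sup>2 / 2) \<in> polys"
  using polys_scale[OF polys_power[OF polys_ysum, of 2], of "1 / 2"] by simp

lemma euler_x_add: "f \<in> polys \<Longrightarrow> g \<in> polys \<Longrightarrow> euler_x (\<lambda>z. f z + g z) = (\<lambda>z. euler_x f z + euler_x g z)"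
  by (simp add: euler_x_def fun_eq_iff dx_eq_dir_deriv dir_deriv_add sum.distrib algebra_simps)

lemma euler_x_diff: "f \<in> polys \<Longrightarrow> g \<in> polys \<Longrightarrow> euler_x (\<lambda>z. f z - g z) = (\<lambda>z. euler_x f z - euler_x g z)"
  by (simp add: euler_x_def fun_eq_iff dx_eq_dir_deriv dir_deriv_diff sum_subtractf algebra_simps)

lemma euler_x_sum: "(\<And>i. i \<in> I \<Longrightarrow> f i \<in> polys) \<Longrightarrow> euler_x (\<lambda>z. \<Sum>i\<in>I. f i z) = (\<lambda>z. \<Sum>i\<in>I. euler_x (f i) z)"
  by (rule ext, simp add: euler_x_def dx_eq_dir_deriv dir_deriv_sum sum_distrib_left, rule sum.swap)

lemma laplace_x_diff: "f \<in> polys \<Longrightarrow> g \<in> polys \<Longrightarrow> laplace_x (\<lambda>z. f z - g z) = (\<lambda>z. laplace_x f z - laplace_x g z)"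
  by (simp add: laplace_x_def fun_eq_iff dx_eq_dir_deriv dir_deriv_diff polys_dir_deriv sum_subtractf)

lemma euler_x_mult_const:
  assumes "q \<in> polys" "f \<in> polys" and q: "\<And>i. dx i q = (\<lambda>z. 0)"
  shows "euler_x (\<lambda>z. q z * f z) = (\<lambda>z. q z * euler_x f z)"
  using assms by (simp add: euler_x_def fun_eq_iff dx_eq_dir_deriv dir_deriv_mult sum_distrib_left algebra_simps)

lemma laplace_x_mult_const:
  assumes "q \<in> polys" "f \<in> polys" and q: "\<And>i. dx i q = (\<lambda>z. 0)"
  shows "laplace_x (\<lambda>z. q z * f z) = (\<lambda>z. q z * laplace_x f z)"
  using assms by (simp add: laplace_x_def[abs_def] dx_eq_dir_deriv dir_deriv_mult polys_dir_deriv sum_distrib_left)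

lemma dx_ysum: "dx i (\<lambda>z. ysum (snd z)) = (\<lambda>z. 0)"
  by (simp add: dx_eq_dir_deriv dir_deriv_ysum ysum_zero)

lemma dx_half_square: "dx i (\<lambda>z. (ysum (snd z))\<^sup>2 / 2) = (\<lambda>z. 0)"
proof -
  have "dx i (\<lambda>z. (1 / 2) * (ysum (snd z) * ysum (snd z))) = (\<lambda>z. 0)"
    by (simp only: dx_eq_dir_deriv dir_deriv_scale dir_deriv_mult polys_ysum polys_mult dir_deriv_ysum) (simp add: ysum_zero)
  then show ?thesis by (simp add: power2_eq_square)
qed

lemma dy_euler_x: "u \<in> polys \<Longrightarrow> dy j (euler_x u) = euler_x (dy j u)"
  by (simp add: euler_x_def[abs_def] dx_eq_dir_deriv dy_eq_dir_deriv dir_deriv_sum dir_deriv_mult polys_intros polys_dir_deriv dir_deriv_fst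
      dir_deriv_commute[of u "(0, axis j 1)"])

lemma dx_euler_x:
  fixes u :: "('m::finite, 'n::finite) point \<Rightarrow> real"
  assumes u: "u \<in> polys"
  shows "dx i (euler_x u) = (\<lambda>z. dx i u z + euler_x (dx i u) z)"
proof -
  have "(\<Sum>k\<in>UNIV. axis i 1 $ k * dx k u z) = (\<Sum>k\<in>UNIV. if k = i then dx k u z else 0)" for z
    by (rule sum.cong) (auto simp: axis_nth)
  then have *: "(\<Sum>k\<in>UNIV. axis i 1 $ k * dx k u z) = dx i u z" for z by simp
  have "dx i (euler_x u) = (\<lambda>z. (\<Sum>k\<in>UNIV. axis i 1 $ k * dx k u z) + (\<Sum>k\<in>UNIV. fst z $ k * dx i (dx k u) z))"
    using u by (simp add: euler_x_def[abs_def] dx_eq_dir_deriv dir_deriv_sum dir_deriv_mult polys_intros polys_dir_deriv dir_deriv_fst sum.distrib)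
  also have "\<dots> = (\<lambda>z. dx i u z + euler_x (dx i u) z)"
    unfolding * using u by (simp add: euler_x_def dx_eq_dir_deriv dir_deriv_commute[of u "(axis i 1, 0)"])
  finally show ?thesis .
qed

lemma laplace_x_euler_x:
  assumes u: "u \<in> polys"
  shows "laplace_x (euler_x u) = (\<lambda>z. euler_x (laplace_x u) z + 2 * laplace_x u z)"
proof -
  have "dx i (dx i (euler_x u)) = (\<lambda>z. 2 * dx i (dx i u) z + euler_x (dx i (dx i u)) z)" for i
  proof -
    have "dx i (dx i (euler_x u)) = dx i (\<lambda>z. dx i u z + euler_x (dx i u) z)" by (simp add: dx_euler_x u)
    also have "\<dots> = (\<lambda>z. dx i (dx i u) z + dx i (euler_x (dx i u)) z)"
      using u by (simp add: dx_eq_dir_deriv dir_deriv_add polys_dir_deriv polys_euler_x)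
    finally show ?thesis by (simp add: dx_euler_x polys_dx u)
  qed
  moreover have "euler_x (laplace_x u) = (\<lambda>z. \<Sum>i\<in>UNIV. euler_x (dx i (dx i u)) z)"
    unfolding laplace_x_def[abs_def] by (intro euler_x_sum polys_dx u)
  ultimately show ?thesis
    by (simp add: laplace_x_def[of "euler_x u"] laplace_x_def[of u] fun_eq_iff sum.distrib sum_distrib_left)
qed

text \<open>
  In the variable \<open>s = x / |y|\<close> this is \<open>\<Delta>\<^sub>s / 2 - \<langle>s, \<nabla>\<^sub>s\<rangle>\<close>, the Hermite operator of the
  weight \<open>exp (- \<parallel>s\<parallel>\<^sup>2)\<close>.
\<close>

definition hermite_op :: "(('m::finite, 'n::finite) point \<Rightarrow> real) \<Rightarrow> ('m, 'n) point \<Rightarrow> real" where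
  "hermite_op u z = (ysum (snd z))\<^sup>2 / 2 * laplace_x u z - euler_x u z"

lemma polys_hermite_op: "u \<in> polys \<Longrightarrow> hermite_op u \<in> polys"
  unfolding hermite_op_def[abs_def] by (intro polys_diff polys_mult polys_half_square polys_laplace_x polys_euler_x)

text \<open>
  Expansion of \<open>H\<^sup>2\<close> by \<open>[\<Delta>, \<langle>x, \<nabla>\<^sub>x\<rangle>] = 2 \<Delta>\<close>; the function \<open>|y|\<^sup>2 / 2\<close> is constant in \<open>x\<close>. This is the
  source of the fourth-order term.
\<close>

lemma hermite_op_hermite_op:
  assumes u: "u \<in> polys"
  shows "hermite_op (hermite_op u) z = ysum (snd z) ^ 4 / 4 * laplace_x (laplace_x u) z
    - (ysum (snd z))\<^sup>2 * euler_x (laplace_x u) z - (ysum (snd z))\<^sup>2 * laplace_x u z + euler_x (euler_x u) z"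
proof -
  note P = u polys_mult polys_half_square polys_laplace_x polys_euler_x
  have "laplace_x (hermite_op u) = (\<lambda>z. (ysum (snd z))\<^sup>2 / 2 * laplace_x (laplace_x u) z - (euler_x (laplace_x u) z + 2 * laplace_x u z))"
    unfolding hermite_op_def[abs_def]
    by (simp only: laplace_x_diff[OF polys_mult[OF polys_half_square polys_laplace_x[OF u]] polys_euler_x[OF u]]
        laplace_x_mult_const[OF polys_half_square polys_laplace_x[OF u] dx_half_square] laplace_x_euler_x[OF u])
  moreover have "euler_x (hermite_op u) = (\<lambda>z. (ysum (snd z))\<^sup>2 / 2 * euler_x (laplace_x u) z - euler_x (euler_x u) z)"
    unfolding hermite_op_def[abs_def]
    by (simp only: euler_x_diff[OF polys_mult[OF polys_half_square polys_laplace_x[OF u]] polys_euler_x[OF u]]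
        euler_x_mult_const[OF polys_half_square polys_laplace_x[OF u] dx_half_square])
  ultimately show ?thesis
    by (simp add: hermite_op_def[of "hermite_op u"] field_simps power2_eq_square power4_eq_xxxx)
qed

text \<open>
  The field \<open>t \<partial>\<^sub>t\<close> along the rays \<open>x = t s\<close> with \<open>s\<close> and \<open>y'\<close> fixed, where \<open>t = |y|\<close>.
\<close>

definition cone_dil :: "'n \<Rightarrow> (('m::finite, 'n::finite) point \<Rightarrow> real) \<Rightarrow> ('m, 'n) point \<Rightarrow> real" where
  "cone_dil l f z = ysum (snd z) * dy l f z + euler_x f z"

lemma polys_cone_dil: "f \<in> polys \<Longrightarrow> cone_dil l f \<in> polys"
  unfolding cone_dil_def[abs_def] by (intro polys_intros polys_dy polys_euler_x)

lemma cone_dil_add: "f \<in> polys \<Longrightarrow> g \<in> polys \<Longrightarrow> cone_dil l (\<lambda>z. f z + g z) = (\<lambda>z. cone_dil l f z + cone_dil l g z)"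
  by (simp add: cone_dil_def fun_eq_iff euler_x_def dy_eq_dir_deriv dx_eq_dir_deriv dir_deriv_add sum.distrib algebra_simps)

lemma cone_dil_scale: "f \<in> polys \<Longrightarrow> cone_dil l (\<lambda>z. c * f z) = (\<lambda>z. c * cone_dil l f z)"
  by (simp add: cone_dil_def fun_eq_iff euler_x_def dy_eq_dir_deriv dx_eq_dir_deriv dir_deriv_scale sum_distrib_left algebra_simps)

lemma cone_dil_cone_dil:
  assumes u: "u \<in> polys"
  shows "cone_dil l (cone_dil l u) z = ysum (snd z) * dy l u z + (ysum (snd z))\<^sup>2 * dy l (dy l u) z
    + 2 * ysum (snd z) * euler_x (dy l u) z + euler_x (euler_x u) z"
proof -
  have "dy l (cone_dil l u) = (\<lambda>z. dy l u z + ysum (snd z) * dy l (dy l u) z + dy l (euler_x u) z)"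
    using u by (simp add: cone_dil_def[abs_def] dy_eq_dir_deriv dir_deriv_add dir_deriv_mult dir_deriv_ysum ysum_axis polys_intros polys_dir_deriv polys_euler_x)
  moreover have "euler_x (cone_dil l u) = (\<lambda>z. ysum (snd z) * euler_x (dy l u) z + euler_x (euler_x u) z)"
    unfolding cone_dil_def[abs_def]
    by (simp only: euler_x_add[OF polys_mult[OF polys_ysum polys_dy[OF u]] polys_euler_x[OF u]]
        euler_x_mult_const[OF polys_ysum polys_dy[OF u] dx_ysum])
  ultimately show ?thesis
    by (simp add: cone_dil_def[of l "cone_dil l u"] dy_euler_x u algebra_simps power2_eq_square)
qed

text \<open>
  The derivative with respect to \<open>y\<^sub>j\<close> when \<open>|y|\<close>, instead of \<open>y\<^sub>l\<close>, is kept fixed.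
\<close>

definition shear_deriv :: "'n \<Rightarrow> 'n \<Rightarrow> (('m::finite, 'n::finite) point \<Rightarrow> real) \<Rightarrow> ('m, 'n) point \<Rightarrow> real" where
  "shear_deriv l j = dir_deriv (0, axis j 1 - axis l 1)"

lemma shear_deriv_eq: "f \<in> polys \<Longrightarrow> shear_deriv l j f = (\<lambda>z. dy j f z - dy l f z)"
  using dir_deriv_direction_diff[of f "(0, axis j 1)" "(0, axis l 1)"] by (simp add: shear_deriv_def dy_eq_dir_deriv)

lemma polys_shear_deriv: "f \<in> polys \<Longrightarrow> shear_deriv l j f \<in> polys" by (simp add: shear_deriv_def polys_dir_deriv)

lemma shear_deriv_ysum: "shear_deriv l j (\<lambda>z. ysum (snd z)) = (\<lambda>z. 0)"
  by (simp add: shear_deriv_def dir_deriv_ysum ysum_diff ysum_axis)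

text \<open>
  After multiplication by \<open>|y|\<close> the operator splits into a Laguerre operator \<open>T\<^sup>2 + (\<alpha> - t) T\<close> along rays, the
  polynomial \<open>- H\<^sup>2 + \<alpha> H\<close> in the Hermite operator, and one Laguerre operator for each \<open>y\<^sub>j\<close> with \<open>j \<noteq> l\<close>. Both
  sides are compared as combinations of derivatives of \<open>u\<close>.
\<close>

lemma D_RSigma_factorisation:
  fixes u :: "('m::finite, 'n::finite) point \<Rightarrow> real" and l :: 'n and \<kappa> :: "real^'n"
  assumes u: "u \<in> polys"
  defines "\<alpha> \<equiv> \<kappa> $ l + real CARD('m)"
  shows "ysum (snd z) * D_RSigma l \<kappa> u z =
    cone_dil l (cone_dil l u) z + (\<alpha> - ysum (snd z)) * cone_dil l u z - hermite_op (hermite_op u) z + \<alpha> * hermite_op u z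
    + (\<Sum>j\<in>UNIV - {l}. ysum (snd z) * (snd z $ j * shear_deriv l j (shear_deriv l j u) z + (\<kappa> $ j + 1 - snd z $ j) * shear_deriv l j u z))"
proof -
  let ?t = "ysum (snd z)"
  have comm: "dy l (dy j u) = dy j (dy l u)" for j using u by (simp add: dy_eq_dir_deriv dir_deriv_commute)
  have second: "shear_deriv l j (shear_deriv l j u) z = dy j (dy j u) z - 2 * dy j (dy l u) z + dy l (dy l u) z" for j
  proof -
    have "shear_deriv l j (shear_deriv l j u) = shear_deriv l j (\<lambda>z. dy j u z - dy l u z)" using u by (simp add: shear_deriv_eq)
    also have "\<dots> = (\<lambda>z. shear_deriv l j (dy j u) z - shear_deriv l j (dy l u) z)"
      using u by (simp add: shear_deriv_def dir_deriv_diff polys_dy)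
    finally show ?thesis using u by (simp add: shear_deriv_eq polys_dy comm[of j])
  qed
  have first: "shear_deriv l j u z = dy j u z - dy l u z" for j using u by (simp add: shear_deriv_eq)
  have S: "(\<Sum>j\<in>UNIV. g j) = g l + (\<Sum>j\<in>UNIV - {l}. g j)" for g :: "'n \<Rightarrow> real"
    by (rule sum.remove) auto
  have card: "real CARD('n) - 1 = (\<Sum>j\<in>UNIV - {l}. 1)"
    by (simp add: card_Diff_singleton of_nat_diff Suc_le_eq)
  \<comment> \<open>The terms without derivatives in \<open>x\<close>, collected in the coordinates in which \<open>ysum\<close> replaces \<open>y $ l\<close>.\<close>
  define A where "A j = dy j (dy j u) z" for j
  define B where "B j = dy j (dy l u) z" for j
  define C where "C j = dy j u z" for j
  define y where "y = snd z"
  have t: "?t = y $ l + (\<Sum>j\<in>UNIV - {l}. y $ j)" unfolding ysum_def y_def by (rule S)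
  have AB: "A l = B l" by (simp add: A_def B_def)
  have main: "(\<Sum>j\<in>UNIV. y $ j * A j + (\<kappa> $ j + 1 - y $ j) * C j) - 2 * (\<Sum>j\<in>UNIV. y $ j * B j) + 2 * ?t * B l
      - (ysum' l \<kappa> - real CARD('m) + real CARD('n) - 1) * C l
    = (\<Sum>j\<in>UNIV - {l}. y $ j * (A j - 2 * B j + B l) + (\<kappa> $ j + 1 - y $ j) * (C j - C l))
      + ?t * B l + (\<alpha> + 1 - ?t) * C l"
  proof -
    have "ysum' l \<kappa> - real CARD('m) + real CARD('n) - 1 = (\<Sum>j\<in>UNIV - {l}. \<kappa> $ j) + (\<Sum>j\<in>UNIV - {l}. 1) - real CARD('m)"
      using card by (simp add: ysum'_def)
    then show ?thesis
      unfolding S[of "\<lambda>j. y $ j * A j + (\<kappa> $ j + 1 - y $ j) * C j"] S[of "\<lambda>j. y $ j * B j"] t \<alpha>_def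
      by (simp add: AB algebra_simps sum.distrib sum_subtractf sum_distrib_left sum_distrib_right)
  qed
  have "D_RSigma l \<kappa> u z = - (1/4) * ?t ^ 3 * laplace_x (laplace_x u) z + ?t * euler_x (laplace_x u) z
      + (1 + (1/2) * \<alpha>) * ?t * laplace_x u z + 2 * euler_x (dy l u) z - euler_x u z
      + ((\<Sum>j\<in>UNIV. y $ j * A j + (\<kappa> $ j + 1 - y $ j) * C j) - 2 * (\<Sum>j\<in>UNIV. y $ j * B j) + 2 * ?t * B l
      - (ysum' l \<kappa> - real CARD('m) + real CARD('n) - 1) * C l)"
    by (simp add: D_RSigma_def case_prod_beta' A_def B_def C_def y_def euler_y_def \<alpha>_def)
  also note main
  finally have D: "D_RSigma l \<kappa> u z = - (1/4) * ?t ^ 3 * laplace_x (laplace_x u) z + ?t * euler_x (laplace_x u) z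
      + (1 + (1/2) * \<alpha>) * ?t * laplace_x u z + 2 * euler_x (dy l u) z - euler_x u z
      + ((\<Sum>j\<in>UNIV - {l}. snd z $ j * shear_deriv l j (shear_deriv l j u) z + (\<kappa> $ j + 1 - snd z $ j) * shear_deriv l j u z)
      + ?t * dy l (dy l u) z + (\<alpha> + 1 - ?t) * dy l u z)"
    by (simp add: second first A_def B_def C_def y_def)
  show ?thesis
    unfolding D hermite_op_hermite_op[OF u] cone_dil_cone_dil[OF u] hermite_op_def[of u] cone_dil_def[of l u] sum_distrib_left[symmetric]
    by (simp add: algebra_simps power2_eq_square power3_eq_cube power4_eq_xxxx)
qed

section \<open>Monomials in the sheared coordinates\<close>

definition shear_coord :: "'n \<Rightarrow> 'n \<Rightarrow> ('m::finite, 'n::finite) point \<Rightarrow> real" where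
  "shear_coord l j z = (if j = l then ysum (snd z) else snd z $ j)"

text \<open>
  Monomials in \<open>x\<close>, \<open>|y|\<close> and the \<open>y\<^sub>j\<close> with \<open>j \<noteq> l\<close>; these coordinates separate the weight.
\<close>

definition shear_mon :: "'n \<Rightarrow> ('m \<Rightarrow> nat) \<Rightarrow> ('n \<Rightarrow> nat) \<Rightarrow> ('m::finite, 'n::finite) point \<Rightarrow> real" where
  "shear_mon l a b z = (\<Prod>i\<in>UNIV. (fst z $ i) ^ a i) * (\<Prod>j\<in>UNIV. shear_coord l j z ^ b j)"

lemma polys_shear_coord: "shear_coord l j \<in> polys"
  using polys_ysum polys_snd[of j] by (cases "j = l") (simp_all add: shear_coord_def[abs_def])

lemma polys_shear_mon: "shear_mon l a b \<in> polys"
  unfolding shear_mon_def[abs_def] by (intro polys_intros polys_shear_coord)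

lemma shear_mon_mult_fst: "fst z $ i * shear_mon l a b z = shear_mon l (a(i := Suc (a i))) b z"
  unfolding shear_mon_def mult.assoc[symmetric]
  by (rule arg_cong2[of _ _ _ _ "(*)"], rule prod_change_one[symmetric]) auto

lemma shear_mon_mult_shear_coord: "shear_coord l j z * shear_mon l a b z = shear_mon l a (b(j := Suc (b j))) z"
  unfolding shear_mon_def mult.left_commute[of "shear_coord l j z"]
  by (rule arg_cong2[of _ _ _ _ "(*)"], rule refl, rule prod_change_one[symmetric]) auto

inductive shear_span :: "'n \<Rightarrow> (('m::finite, 'n::finite) point \<Rightarrow> real) \<Rightarrow> bool" for l where
  shear_mon: "shear_span l (\<lambda>z. c * shear_mon l a b z)"
| add: "shear_span l f \<Longrightarrow> shear_span l g \<Longrightarrow> shear_span l (\<lambda>z. f z + g z)"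

lemma shear_span_polys: "shear_span l f \<Longrightarrow> f \<in> polys"
  by (induction rule: shear_span.induct) (auto intro: polys_intros polys_shear_mon)

lemma shear_span_mult:
  assumes "\<And>a b. \<exists>a' b'. \<forall>z. \<xi> z * shear_mon l a b z = shear_mon l a' b' z" and "shear_span l f"
  shows "shear_span l (\<lambda>z. \<xi> z * f z)"
  using assms(2)
proof (induction rule: shear_span.induct)
  case (shear_mon c a b)
  obtain a' b' where "\<And>z. \<xi> z * shear_mon l a b z = shear_mon l a' b' z" using assms(1) by blast
  then have "(\<lambda>z. \<xi> z * (c * shear_mon l a b z)) = (\<lambda>z. c * shear_mon l a' b' z)" by (simp add: mult.left_commute)
  then show ?case by (simp add: shear_span.shear_mon)
next
  case (add f g)
  then show ?case using shear_span.add by (simp add: distrib_left)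
qed

lemma shear_span_scale: "shear_span l f \<Longrightarrow> shear_span l (\<lambda>z. c * f z)"
proof (induction rule: shear_span.induct)
  case (shear_mon d a b)
  then show ?case using shear_span.shear_mon[of l "c * d" a b] by (simp add: mult.assoc)
next
  case (add f g)
  then show ?case using shear_span.add by (simp add: distrib_left)
qed

lemma shear_span_sum: "(\<And>i. i \<in> I \<Longrightarrow> shear_span l (f i)) \<Longrightarrow> shear_span l (\<lambda>z. \<Sum>i\<in>I. f i z)"
proof (induction I rule: infinite_finite_induct)
  case (insert i I)
  then show ?case using shear_span.add[of l "f i"] by simp
qed (use shear_span.shear_mon[of l 0] in simp_all)

lemma polys_shear_span: "f \<in> polys \<Longrightarrow> shear_span l f"
proof (induction rule: polys_induct)
  case (const c)
  show ?case using shear_span.shear_mon[of l c "\<lambda>_. 0" "\<lambda>_. 0"] by (simp add: shear_mon_def)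
next
  case (coord f \<xi>)
  have sc: "shear_span l (\<lambda>z. shear_coord l j z * f z)" for j
    using shear_mon_mult_shear_coord coord by (intro shear_span_mult) blast+
  from coord.hyps(2) show ?case
  proof (cases rule: coords_cases)
    case (1 i)
    show ?thesis unfolding 1 using shear_mon_mult_fst coord by (intro shear_span_mult) blast+
  next
    case (2 j)
    show ?thesis
    proof (cases "j = l")
      case False
      then show ?thesis using sc[of j] by (simp add: 2 shear_coord_def)
    next
      case True
      \<comment> \<open>The original coordinate \<open>l\<close> is \<open>ysum\<close> minus the other coordinates.\<close>
      have "shear_span l (\<lambda>z. shear_coord l l z * f z + (- 1) * (\<Sum>k\<in>UNIV - {l}. shear_coord l k z * f z))"
        by (intro shear_span.add shear_span_scale shear_span_sum sc)
      moreover have "snd z $ l * f z = shear_coord l l z * f z + (- 1) * (\<Sum>k\<in>UNIV - {l}. shear_coord l k z * f z)" for z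
      proof -
        have "ysum (snd z) = snd z $ l + (\<Sum>k\<in>UNIV - {l}. shear_coord l k z)"
          unfolding ysum_def by (subst sum.remove[of _ l]) (auto simp: shear_coord_def)
        then show ?thesis by (simp add: shear_coord_def[of l l] sum_distrib_right[symmetric]) (simp add: algebra_simps)
      qed
      ultimately show ?thesis by (simp add: 2 True)
    qed
  qed
next
  case (add f g)
  then show ?case by (intro shear_span.add)
qed

text \<open>
  Linear identities between polynomials need only be checked on shear monomials.
\<close>

lemma polys_shear_mon_induct [consumes 1, case_names shear_mon add]:
  assumes "f \<in> polys" and "\<And>c a b. P (\<lambda>z. c * shear_mon l a b z)"
    and "\<And>f g. f \<in> polys \<Longrightarrow> g \<in> polys \<Longrightarrow> P f \<Longrightarrow> P g \<Longrightarrow> P (\<lambda>z. f z + g z)"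
  shows "P f"
  using polys_shear_span[OF assms(1), of l]
  by (induction rule: shear_span.induct) (auto intro: assms shear_span_polys)

section \<open>Derivations and their eigenfunctions\<close>

definition derivation :: "((('m::finite, 'n::finite) point \<Rightarrow> real) \<Rightarrow> ('m, 'n) point \<Rightarrow> real) \<Rightarrow> bool" where
  "derivation X \<longleftrightarrow> (\<forall>f\<in>polys. \<forall>g\<in>polys. X (\<lambda>z. f z * g z) = (\<lambda>z. X f z * g z + f z * X g z))"

lemma derivation_mult:
  "derivation X \<Longrightarrow> f \<in> polys \<Longrightarrow> g \<in> polys \<Longrightarrow> X (\<lambda>z. f z * g z) = (\<lambda>z. X f z * g z + f z * X g z)"
  by (simp add: derivation_def)

lemma derivation_one: "derivation X \<Longrightarrow> X (\<lambda>z. 1) = (\<lambda>z. 0)"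
  using derivation_mult[of X "\<lambda>z. 1" "\<lambda>z. 1"] by (simp add: polys_const fun_eq_iff)

lemma derivation_eigen_power:
  assumes X: "derivation X" and f: "f \<in> polys" and ev: "k \<noteq> 0 \<Longrightarrow> X f = (\<lambda>z. c * f z)"
  shows "X (\<lambda>z. f z ^ k) = (\<lambda>z. real k * c * f z ^ k)"
proof (cases "k = 0")
  case True
  then show ?thesis by (simp add: derivation_one X)
next
  case False
  then have Xf: "X f = (\<lambda>z. c * f z)" by (rule ev)
  show ?thesis
  proof (induction k)
    case (Suc k)
    then show ?case
      using derivation_mult[OF X f polys_power[OF f, of k]] by (simp add: Xf algebra_simps)
  qed (simp add: derivation_one X)
qed

lemma derivation_eigen_prod:
  assumes X: "derivation X" and "\<And>i. i \<in> I \<Longrightarrow> f i \<in> polys" "\<And>i. i \<in> I \<Longrightarrow> X (f i) = (\<lambda>z. c i * f i z)"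
    and "finite I"
  shows "X (\<lambda>z. \<Prod>i\<in>I. f i z) = (\<lambda>z. (\<Sum>i\<in>I. c i) * (\<Prod>i\<in>I. f i z))"
  using assms(4,2,3)
proof (induction I rule: finite_induct)
  case (insert i I)
  then show ?case
    using derivation_mult[OF X, of "f i" "\<lambda>z. \<Prod>i\<in>I. f i z"] by (simp add: polys_prod algebra_simps)
qed (simp add: derivation_one X)

text \<open>
  The eigenvalues of a derivation add up under products. The hypotheses concern only the coordinates
  that occur in the monomial, which allows \<open>X\<close> to be a plain derivative that kills them.
\<close>

lemma derivation_eigen_shear_mon:
  assumes X: "derivation X"
    and x: "\<And>i. a i \<noteq> 0 \<Longrightarrow> X (\<lambda>z. fst z $ i) = (\<lambda>z. cx i * fst z $ i)"
    and y: "\<And>j. b j \<noteq> 0 \<Longrightarrow> X (shear_coord l j) = (\<lambda>z. cy j * shear_coord l j z)"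
  shows "X (shear_mon l a b) = (\<lambda>z. ((\<Sum>i\<in>UNIV. real (a i) * cx i) + (\<Sum>j\<in>UNIV. real (b j) * cy j)) * shear_mon l a b z)"
proof -
  have "X (\<lambda>z. \<Prod>i\<in>UNIV. (fst z $ i) ^ a i) = (\<lambda>z. (\<Sum>i\<in>UNIV. real (a i) * cx i) * (\<Prod>i\<in>UNIV. (fst z $ i) ^ a i))"
    by (intro derivation_eigen_prod X derivation_eigen_power x polys_intros) auto
  moreover have "X (\<lambda>z. \<Prod>j\<in>UNIV. shear_coord l j z ^ b j) = (\<lambda>z. (\<Sum>j\<in>UNIV. real (b j) * cy j) * (\<Prod>j\<in>UNIV. shear_coord l j z ^ b j))"
    by (intro derivation_eigen_prod X derivation_eigen_power y polys_intros polys_shear_coord) auto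
  ultimately show ?thesis
    unfolding shear_mon_def[abs_def]
    by (subst derivation_mult[OF X]) (auto intro!: polys_intros polys_shear_coord simp: algebra_simps)
qed

lemma derivation_mult_dir_deriv: "derivation (\<lambda>f z. g z * dir_deriv v f z)"
  by (simp add: derivation_def dir_deriv_mult algebra_simps)

lemma derivation_dir_deriv: "derivation (dir_deriv v)"
  by (simp add: derivation_def dir_deriv_mult)

lemma derivation_euler_x: "derivation euler_x"
  by (auto simp: derivation_def euler_x_def dx_eq_dir_deriv dir_deriv_mult fun_eq_iff sum.distrib sum_distrib_left
      sum_distrib_right algebra_simps intro!: sum.cong)

lemma derivation_cone_dil: "derivation (cone_dil l)"
  using derivation_euler_x
  by (simp add: derivation_def cone_dil_def fun_eq_iff dy_eq_dir_deriv dir_deriv_mult algebra_simps)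

lemma cone_dil_shear_mon:
  fixes a :: "'m::finite \<Rightarrow> nat" and b :: "'n::finite \<Rightarrow> nat"
  shows "cone_dil l (shear_mon l a b) = (\<lambda>z. (real (sum a UNIV) + real (b l)) * shear_mon l a b z)"
proof -
  have ex: "euler_x (\<lambda>z :: ('m, 'n) point. fst z $ i) = (\<lambda>z. fst z $ i)" for i
  proof -
    have "(\<Sum>k\<in>UNIV. fst z $ k * axis k 1 $ i) = (\<Sum>k\<in>UNIV. if k = i then fst z $ k else 0)" for z :: "('m, 'n) point"
      by (rule sum.cong) (auto simp: axis_nth)
    then show ?thesis by (simp add: euler_x_def fun_eq_iff dx_eq_dir_deriv dir_deriv_fst)
  qed
  have "cone_dil l (shear_mon l a b) = (\<lambda>z. ((\<Sum>i\<in>UNIV. real (a i) * 1)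
      + (\<Sum>j\<in>UNIV. real (b j) * (if j = l then 1 else 0))) * shear_mon l a b z)"
  proof (rule derivation_eigen_shear_mon[OF derivation_cone_dil])
    show "cone_dil l (\<lambda>z :: ('m, 'n) point. fst z $ i) = (\<lambda>z. 1 * fst z $ i)" for i
      by (simp add: cone_dil_def fun_eq_iff ex) (simp add: dy_eq_dir_deriv dir_deriv_fst)
    show "cone_dil l (shear_coord l j) = (\<lambda>z. (if j = l then 1 else 0) * shear_coord l j z)" for j
      by (cases "j = l") (auto simp: cone_dil_def fun_eq_iff shear_coord_def[abs_def] euler_x_def dx_eq_dir_deriv dy_eq_dir_deriv
          dir_deriv_snd dir_deriv_ysum ysum_axis ysum_zero axis_nth)
  qed
  then show ?thesis by (simp add: if_distrib of_nat_sum cong: if_cong)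
qed

lemma shear_deriv_shear_mon:
  assumes "j \<noteq> l"
  shows "snd z $ j * shear_deriv l j (shear_mon l a b) z = real (b j) * shear_mon l a b z"
proof -
  have "(\<lambda>z. snd z $ j * shear_deriv l j (shear_mon l a b) z) = (\<lambda>z. ((\<Sum>i\<in>UNIV. real (a i) * 0)
      + (\<Sum>k\<in>UNIV. real (b k) * (if k = j then 1 else 0))) * shear_mon l a b z)"
    unfolding shear_deriv_def
  proof (rule derivation_eigen_shear_mon[OF derivation_mult_dir_deriv])
    show "(\<lambda>z. snd z $ j * dir_deriv (0, axis j 1 - axis l 1) (shear_coord l k) z) =
        (\<lambda>z. (if k = j then 1 else 0) * shear_coord l k z)" for k
      using assms by (cases "k = l") (auto simp: fun_eq_iff shear_coord_def[abs_def] dir_deriv_snd dir_deriv_ysum ysum_diff ysum_axis axis_nth)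
  qed (simp add: dir_deriv_fst)
  from fun_cong[OF this, of z] show ?thesis by (simp add: if_distrib cong: if_cong)
qed

lemma dx_shear_mon_0:
  assumes "a i = 0"
  shows "dx i (shear_mon l a b) = (\<lambda>z. 0)"
proof -
  have "dx i (shear_mon l a b) = (\<lambda>z. ((\<Sum>i\<in>UNIV. real (a i) * 0) + (\<Sum>k\<in>UNIV. real (b k) * 0)) * shear_mon l a b z)"
    unfolding dx_eq_dir_deriv
  proof (rule derivation_eigen_shear_mon[OF derivation_dir_deriv])
    show "dir_deriv (axis i 1, 0) (\<lambda>z. fst z $ k) = (\<lambda>z. 0 * fst z $ k)" if "a k \<noteq> 0" for k
      using that assms by (cases "k = i") (auto simp: dir_deriv_fst axis_nth)
    show "dir_deriv (axis i 1, 0) (shear_coord l k) = (\<lambda>z. 0 * shear_coord l k z)" for k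
      by (cases "k = l") (auto simp: shear_coord_def[abs_def] dir_deriv_snd dir_deriv_ysum ysum_zero)
  qed
  then show ?thesis by simp
qed

text \<open>
  By induction on the exponent: the eigenvalue equation of \<open>x\<^sub>i \<partial>\<^sub>i\<close> would give the derivative only where
  \<open>x\<^sub>i \<noteq> 0\<close>.
\<close>

lemma dx_shear_mon_Suc: "dx i (shear_mon l (a(i := Suc (a i))) b) = (\<lambda>z. (real (a i) + 1) * shear_mon l a b z)"
proof (induction "a i" arbitrary: a)
  case 0
  have "dx i (\<lambda>z. fst z $ i * shear_mon l a b z) = (\<lambda>z. shear_mon l a b z)"
    using 0 by (simp add: dx_eq_dir_deriv dir_deriv_mult dir_deriv_fst polys_intros polys_shear_mon) (simp add: dx_eq_dir_deriv[symmetric] dx_shear_mon_0 axis_nth)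
  then show ?case by (simp only: shear_mon_mult_fst 0(1)[symmetric] of_nat_0 add_0 mult_1)
next
  case (Suc k)
  have "(a(i := k))(i := Suc ((a(i := k)) i)) = a" using Suc.hyps(2) by auto
  with Suc.hyps(1)[of "a(i := k)"] have *: "dx i (shear_mon l a b) = (\<lambda>z. (real k + 1) * shear_mon l (a(i := k)) b z)" by simp
  have **: "fst z $ i * shear_mon l (a(i := k)) b z = shear_mon l a b z" for z
    using Suc.hyps(2) by (simp add: shear_mon_mult_fst)
  have "dx i (\<lambda>z. fst z $ i * shear_mon l a b z) = (\<lambda>z. shear_mon l a b z + fst z $ i * dx i (shear_mon l a b) z)"
    by (simp add: dx_eq_dir_deriv dir_deriv_mult dir_deriv_fst polys_intros polys_shear_mon axis_nth)
  also have "\<dots> = (\<lambda>z. (real (a i) + 1) * shear_mon l a b z)"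
    using ** Suc.hyps(2)[symmetric] by (simp add: * fun_eq_iff algebra_simps)
  finally show ?case by (simp add: shear_mon_mult_fst)
qed

section \<open>Shears and products of integrals\<close>

lemma borel_measurable_vec_nth_comp [measurable (raw)]:
  "f \<in> borel_measurable M \<Longrightarrow> (\<lambda>x. (f x :: real^'n) $ i) \<in> borel_measurable M"
  by (rule measurable_compose[of f M borel]) (auto intro!: borel_measurable_continuous_onI continuous_intros)

text \<open>
  A shear along a basis vector is a translation on every line in that direction.
\<close>

lemma nn_integral_lborel_shear:
  fixes b :: "'a::euclidean_space"
  assumes b: "b \<in> Basis" and \<phi> [measurable]: "\<phi> \<in> borel_measurable borel"
    and inv: "\<And>x s. \<phi> (x + s *\<^sub>R b) = \<phi> x" and g [measurable]: "g \<in> borel_measurable borel"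
  shows "(\<integral>\<^sup>+x. g (x + \<phi> x *\<^sub>R b) \<partial>lborel) = (\<integral>\<^sup>+x. g x \<partial>(lborel :: 'a measure))"
proof -
  interpret product_sigma_finite "\<lambda>_::'a. lborel :: real measure" ..
  define B' where "B' = Basis - {b}"
  have B': "Basis = insert b B'" "b \<notin> B'" "finite B'" using b by (auto simp: B'_def)
  define S0 where "S0 h = (\<Sum>c\<in>B'. h c *\<^sub>R c)" for h :: "'a \<Rightarrow> real"
  \<comment> \<open>Fubini, with the coordinate along \<open>b\<close> integrated first.\<close>
  have *: "(\<integral>\<^sup>+x. f x \<partial>(lborel :: 'a measure)) =
      (\<integral>\<^sup>+h. (\<integral>\<^sup>+y. f (S0 h + y *\<^sub>R b) \<partial>lborel) \<partial>(\<Pi>\<^sub>M c\<in>B'. lborel))"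
    if [measurable]: "f \<in> borel_measurable borel" for f :: "'a \<Rightarrow> ennreal"
  proof -
    have "(\<integral>\<^sup>+x. f x \<partial>(lborel :: 'a measure)) =
        (\<integral>\<^sup>+h. f (\<Sum>c\<in>Basis. h c *\<^sub>R c) \<partial>(\<Pi>\<^sub>M c\<in>Basis. lborel))"
      by (subst lborel_eq) (simp add: nn_integral_distr)
    also have "\<dots> = (\<integral>\<^sup>+h. f (\<Sum>c\<in>insert b B'. h c *\<^sub>R c) \<partial>(\<Pi>\<^sub>M c\<in>insert b B'. lborel))"
      by (simp only: B'(1)[symmetric])
    also have "\<dots> = (\<integral>\<^sup>+h. (\<integral>\<^sup>+y. f (\<Sum>c\<in>insert b B'. (h(b := y)) c *\<^sub>R c) \<partial>lborel) \<partial>(\<Pi>\<^sub>M c\<in>B'. lborel))"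
      by (rule product_nn_integral_insert) (use B' in auto)
    also have "\<dots> = (\<integral>\<^sup>+h. (\<integral>\<^sup>+y. f (S0 h + y *\<^sub>R b) \<partial>lborel) \<partial>(\<Pi>\<^sub>M c\<in>B'. lborel))"
    proof (intro nn_integral_cong arg_cong[of _ _ f])
      fix h y
      have "(\<Sum>c\<in>B'. (h(b := y)) c *\<^sub>R c) = S0 h"
        unfolding S0_def by (rule sum.cong) (use B' in auto)
      then show "(\<Sum>c\<in>insert b B'. (h(b := y)) c *\<^sub>R c) = S0 h + y *\<^sub>R b"
        using B'(2,3) by (simp add: sum.insert[of B' b] add.commute del: sum.insert)
    qed
    finally show ?thesis .
  qed
  \<comment> \<open>By the invariance of \<open>\<phi>\<close> the shear translates the inner variable by the constant \<open>\<phi> (S0 h)\<close>.\<close>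
  have "(\<integral>\<^sup>+x. g (x + \<phi> x *\<^sub>R b) \<partial>lborel) =
      (\<integral>\<^sup>+h. (\<integral>\<^sup>+y. g (S0 h + (\<phi> (S0 h) + 1 * y) *\<^sub>R b) \<partial>lborel) \<partial>(\<Pi>\<^sub>M c\<in>B'. lborel))"
    by (subst *) (simp_all add: inv algebra_simps)
  also have "\<dots> = (\<integral>\<^sup>+h. (\<integral>\<^sup>+y. g (S0 h + y *\<^sub>R b) \<partial>lborel) \<partial>(\<Pi>\<^sub>M c\<in>B'. lborel))"
  proof (rule nn_integral_cong)
    fix h
    show "(\<integral>\<^sup>+y. g (S0 h + (\<phi> (S0 h) + 1 * y) *\<^sub>R b) \<partial>lborel) = (\<integral>\<^sup>+y. g (S0 h + y *\<^sub>R b) \<partial>lborel)"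
      using nn_integral_real_affine[of "\<lambda>y. g (S0 h + y *\<^sub>R b)" 1 "\<phi> (S0 h)"] by simp
  qed
  also have "\<dots> = (\<integral>\<^sup>+x. g x \<partial>lborel)" by (rule *[symmetric]) simp
  finally show ?thesis .
qed

lemma distr_lborel_shear:
  fixes b :: "'a::euclidean_space"
  assumes "b \<in> Basis" and \<phi> [measurable]: "\<phi> \<in> borel_measurable borel"
    and "\<And>x s. \<phi> (x + s *\<^sub>R b) = \<phi> x"
  shows "distr lborel borel (\<lambda>x. x + \<phi> x *\<^sub>R b) = (lborel :: 'a measure)"
proof (rule measure_eqI)
  fix A :: "'a set" assume "A \<in> sets (distr lborel borel (\<lambda>x. x + \<phi> x *\<^sub>R b))"
  then have [measurable]: "A \<in> sets borel" by simp
  have "emeasure (distr lborel borel (\<lambda>x. x + \<phi> x *\<^sub>R b)) A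
      = (\<integral>\<^sup>+x. indicator A x \<partial>distr lborel borel (\<lambda>x. x + \<phi> x *\<^sub>R b))" by simp
  also have "\<dots> = (\<integral>\<^sup>+x. indicator A (x + \<phi> x *\<^sub>R b) \<partial>lborel)" by (rule nn_integral_distr) simp_all
  also have "\<dots> = (\<integral>\<^sup>+x. indicator A x \<partial>lborel)"
    by (rule nn_integral_lborel_shear) (use assms in auto)
  finally show "emeasure (distr lborel borel (\<lambda>x. x + \<phi> x *\<^sub>R b)) A = emeasure lborel A" by simp
qed simp

lemma
  fixes f :: "'n::finite \<Rightarrow> real \<Rightarrow> real"
  assumes f: "\<And>i. integrable lborel (f i)"
  shows integrable_lborel_vec_prod: "integrable lborel (\<lambda>x::real^'n. \<Prod>i\<in>UNIV. f i (x $ i))" (is ?I)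
    and integral_lborel_vec_prod:
      "(\<integral>x. (\<Prod>i\<in>UNIV. f i ((x::real^'n) $ i)) \<partial>lborel) = (\<Prod>i\<in>UNIV. \<integral>s. f i s \<partial>lborel)" (is ?E)
proof -
  interpret product_sigma_finite "\<lambda>_::real^'n. lborel :: real measure" ..
  have [measurable]: "f i \<in> borel_measurable borel" for i using f by (auto dest: borel_measurable_integrable)
  have Basis: "Basis = range (\<lambda>i. axis i 1 :: real^'n)" by (auto simp: Basis_vec_def)
  have inj: "inj (\<lambda>i. axis i 1 :: real^'n)" by (auto simp: inj_def axis_eq_axis)
  define F where "F b = f (THE i. b = (axis i 1 :: real^'n))" for b
  have F: "F (axis i 1) = f i" for i by (simp add: F_def axis_eq_axis)
  have nth: "(\<Sum>b\<in>Basis. h b *\<^sub>R b) $ i = h (axis i 1)" for h :: "real^'n \<Rightarrow> real" and i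
  proof -
    have "(\<Sum>b\<in>Basis. h b *\<^sub>R b) $ i = (\<Sum>k\<in>UNIV. h (axis k 1) * (axis k 1 :: real^'n) $ i)"
      by (simp add: Basis sum.reindex[OF inj])
    also have "\<dots> = (\<Sum>k\<in>UNIV. if k = i then h (axis k 1) else 0)"
      by (rule sum.cong) (auto simp: axis_def)
    finally show ?thesis by simp
  qed
  have prod: "(\<Prod>i\<in>UNIV. f i ((\<Sum>b\<in>Basis. h b *\<^sub>R b) $ i)) = (\<Prod>b\<in>Basis. F b (h b))" for h
    by (simp only: nth) (simp add: Basis prod.reindex[OF inj] F)
  have int: "integrable lborel (F b)" for b by (simp add: F_def f)
  have [measurable]: "(\<lambda>x::real^'n. \<Prod>i\<in>UNIV. f i (x $ i)) \<in> borel_measurable borel" by measurable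
  show ?I
    by (subst lborel_eq, subst integrable_distr_eq) (simp_all only: prod, simp_all add: product_integrable_prod int)
  have "(\<integral>x. (\<Prod>i\<in>UNIV. f i ((x::real^'n) $ i)) \<partial>lborel) = (\<Prod>b\<in>Basis. \<integral>s. F b s \<partial>lborel)"
    by (subst lborel_eq, subst integral_distr) (simp_all only: prod, simp_all add: product_integral_prod int)
  then show ?E by (simp add: Basis prod.reindex[OF inj] F)
qed

section \<open>Gaussian and Gamma integrals\<close>

definition gauss_moment :: "nat \<Rightarrow> real" where
  "gauss_moment k = (\<integral>s. s ^ k * exp (- s\<^sup>2) \<partial>lborel)"

lemma gauss_moment_even:
  "has_bochner_integral lborel (\<lambda>s::real. s ^ (2 * k) * exp (- s\<^sup>2)) (sqrt pi * (fact (2 * k) / (2 ^ (2 * k) * fact k)))"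
proof -
  have "has_bochner_integral lborel (\<lambda>s::real. exp (- s\<^sup>2) * s ^ (2 * k))
      (2 *\<^sub>R (sqrt pi / 2 * (fact (2 * k) / (2 ^ (2 * k) * fact k))))"
    by (rule has_bochner_integral_even_function[OF gaussian_moment_even_pos[of k]]) simp
  then show ?thesis by (simp add: mult.commute)
qed

lemma gauss_moment_odd:
  "has_bochner_integral lborel (\<lambda>s::real. s ^ (2 * k + 1) * exp (- s\<^sup>2)) 0"
  using has_bochner_integral_odd_function[OF gaussian_moment_odd_pos[of k]] by (simp add: mult.commute)

lemma integrable_gauss_moment: "integrable lborel (\<lambda>s::real. s ^ k * exp (- s\<^sup>2))"
proof (cases "even k")
  case True
  then show ?thesis using gauss_moment_even[of "k div 2"] by (auto simp: has_bochner_integral_iff)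
next
  case False
  then show ?thesis using gauss_moment_odd[of "k div 2"] by (auto simp: has_bochner_integral_iff)
qed

lemma gauss_moment_1: "gauss_moment 1 = 0"
  using gauss_moment_odd[of 0] by (simp add: gauss_moment_def has_bochner_integral_iff)

lemma gauss_moment_Suc_Suc: "gauss_moment (k + 2) = (real k + 1) / 2 * gauss_moment k"
proof (cases "even k")
  case True
  then obtain m where k: "k = 2 * m" by blast
  have *: "gauss_moment (2 * m) = sqrt pi * (fact (2 * m) / (2 ^ (2 * m) * fact m))" for m
    using gauss_moment_even[of m] by (simp add: gauss_moment_def has_bochner_integral_iff)
  have "gauss_moment (2 * m + 2) = gauss_moment (2 * (m + 1))" by simp
  also have "\<dots> = (2 * real m + 1) / 2 * gauss_moment (2 * m)"
  proof -
    have "fact (2 * (m + 1)) = (2 * real m + 2) * ((2 * real m + 1) * fact (2 * m))"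
      by (simp add: algebra_simps)
    moreover have "fact (m + 1) = (real m + 1) * (fact m :: real)" by simp
    moreover have "(2::real) ^ (2 * (m + 1)) = 4 * 2 ^ (2 * m)" by simp
    moreover have "sqrt pi * ((2 * x + 2) * ((2 * x + 1) * A) / (4 * P * ((x + 1) * F)))
        = (2 * x + 1) / 2 * (sqrt pi * (A / (P * F)))" if "x \<ge> 0" "P > 0" "F > 0" for x A P F :: real
      using that by (simp add: divide_simps)
    ultimately show ?thesis
      by (simp only: * of_nat_0_le_iff zero_less_power fact_gt_zero zero_less_numeral)
  qed
  finally show ?thesis using k by simp
next
  case False
  then obtain m where k: "k = 2 * m + 1" by (auto elim: oddE)
  have "gauss_moment (2 * m + 1) = 0" for m
    using gauss_moment_odd[of m] by (simp add: gauss_moment_def has_bochner_integral_iff)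
  from this[of m] this[of "m + 1"] show ?thesis using k by simp
qed

lemma
  fixes c :: real
  assumes c: "c > 0"
  shows integrable_gauss_scaled: "integrable lborel (\<lambda>s. s ^ k * exp (- (s\<^sup>2 / c\<^sup>2)))" (is ?I)
    and integral_gauss_scaled:
      "(\<integral>s. s ^ k * exp (- (s\<^sup>2 / c\<^sup>2)) \<partial>lborel) = c ^ (k + 1) * gauss_moment k" (is ?E)
    and integral_gauss_scaled_abs:
      "(\<integral>s. \<bar>s ^ k * exp (- (s\<^sup>2 / c\<^sup>2))\<bar> \<partial>lborel) = c ^ (k + 1) * (\<integral>s. \<bar>s ^ k * exp (- s\<^sup>2)\<bar> \<partial>lborel)" (is ?A)
proof -
  have *: "s ^ k * exp (- (s\<^sup>2 / c\<^sup>2)) = c ^ k * ((0 + (1 / c) * s) ^ k * exp (- (0 + (1 / c) * s)\<^sup>2))" for s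
    using c by (simp add: power_divide field_simps)
  have "integrable lborel (\<lambda>s. (0 + (1 / c) * s) ^ k * exp (- (0 + (1 / c) * s)\<^sup>2))"
    by (rule lborel_integrable_real_affine[OF integrable_gauss_moment]) (use c in auto)
  then show ?I unfolding * by (rule integrable_mult_right)
  have sub: "(\<integral>s. f (0 + (1 / c) * s) \<partial>lborel) = c * (\<integral>s. f s \<partial>lborel)" for f :: "real \<Rightarrow> real"
    using lborel_integral_real_affine[of "1 / c" f 0] c by (simp add: field_simps)
  show ?E unfolding * gauss_moment_def
    by (subst integral_mult_right_zero) (subst sub[of "\<lambda>s. s ^ k * exp (- s\<^sup>2)"], simp)
  have "(\<integral>s. \<bar>s ^ k * exp (- (s\<^sup>2 / c\<^sup>2))\<bar> \<partial>lborel) =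
      (\<integral>s. c ^ k * \<bar>(0 + (1 / c) * s) ^ k * exp (- (0 + (1 / c) * s)\<^sup>2)\<bar> \<partial>lborel)"
    unfolding * using c by (simp add: abs_mult)
  also have "\<dots> = c ^ k * (c * (\<integral>s. \<bar>s ^ k * exp (- s\<^sup>2)\<bar> \<partial>lborel))"
    by (subst integral_mult_right_zero) (subst sub[of "\<lambda>s. \<bar>s ^ k * exp (- s\<^sup>2)\<bar>"], simp)
  finally show ?A by simp
qed

definition gamma_weight :: "real \<Rightarrow> real \<Rightarrow> real" where
  "gamma_weight s r = (if 0 < r then r powr (s - 1) * exp (- r) else 0)"

lemma gamma_weight_measurable [measurable]: "gamma_weight s \<in> borel_measurable borel"
  unfolding gamma_weight_def[abs_def] by measurable

lemma gamma_weight_nonneg: "0 \<le> gamma_weight s r"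
  by (simp add: gamma_weight_def)

lemma gamma_weight_pos: "0 < r \<Longrightarrow> 0 < gamma_weight s r"
  by (auto simp: gamma_weight_def intro!: mult_pos_pos)

lemma power_mult_gamma_weight: "r ^ k * gamma_weight s r = gamma_weight (s + real k) r"
  by (simp add: gamma_weight_def powr_realpow[symmetric] powr_add[symmetric] algebra_simps)

lemma has_bochner_integral_gamma_weight:
  assumes "s > 0"
  shows "has_bochner_integral lborel (gamma_weight s) (Gamma s)"
proof (rule has_bochner_integral_nn_integral)
  have "(\<integral>\<^sup>+r. ennreal (gamma_weight s r) \<partial>lborel) =
      (\<integral>\<^sup>+r. ennreal (r powr (s - 1) / exp r) * indicator {0..} r \<partial>lborel)"
    by (rule nn_integral_cong) (auto simp: gamma_weight_def exp_minus field_simps split: split_indicator)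
  also have "\<dots> = ennreal (Gamma s)"
    by (rule nn_integral_has_integral_lebesgue'[OF _ Gamma_integral_real[OF assms]]) simp
  finally show "(\<integral>\<^sup>+r. ennreal (gamma_weight s r) \<partial>lborel) = ennreal (Gamma s)" .
qed (use assms in \<open>auto simp: gamma_weight_nonneg Gamma_real_pos less_imp_le\<close>)

text \<open>
  Integrating over \<open>x\<close> first and substituting \<open>x = r\<^sub>l s\<close> separates the variables. The shift of the parameter
  in \<open>s'\<close> is the Jacobian \<open>r\<^sub>l ^ CARD('m)\<close> together with the degree in \<open>x\<close>. Positivity is asked of the shifted
  parameters because \<open>s l\<close> is instantiated with \<open>\<kappa>\<^sub>l\<close> plus a degree, which can be negative.
\<close>

lemma
  fixes a :: "'m::finite \<Rightarrow> nat" and s :: "'n::finite \<Rightarrow> real" and l :: 'n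
  defines "F \<equiv> \<lambda>z::(real^'m) \<times> (real^'n).
      (\<Prod>i\<in>UNIV. (fst z $ i) ^ a i * exp (- ((fst z $ i)\<^sup>2 / (snd z $ l)\<^sup>2)))
      * (\<Prod>j\<in>UNIV. gamma_weight (s j) (snd z $ j))"
  defines "s' \<equiv> s(l := s l + real (CARD('m) + sum a UNIV))"
  assumes s': "\<And>j. s' j > 0"
  shows integrable_gauss_gamma: "integrable lborel F" (is ?I)
    and integral_gauss_gamma:
      "integral\<^sup>L lborel F = (\<Prod>i\<in>UNIV. gauss_moment (a i)) * (\<Prod>j\<in>UNIV. Gamma (s' j))" (is ?E)
proof -
  let ?e = "\<lambda>c k s. s ^ k * exp (- (s\<^sup>2 / c\<^sup>2)) :: real"
  define f where "f = (\<lambda>(r::real^'n, x::real^'m). F (x, r))"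
  have [measurable]: "f \<in> borel_measurable (lborel \<Otimes>\<^sub>M lborel)"
    unfolding f_def F_def case_prod_beta' fst_conv snd_conv by measurable
  \<comment> \<open>Rescaling \<open>x\<close> by \<open>r $ l\<close> leaves the power \<open>CARD('m) + sum a UNIV\<close> of \<open>r $ l\<close>, which moves the
    Gamma parameter of the coordinate \<open>l\<close> from \<open>s l\<close> to \<open>s' l\<close>.\<close>
  have gw: "(\<Prod>i\<in>UNIV. (r $ l) ^ (a i + 1) * C i) * (\<Prod>j\<in>UNIV. gamma_weight (s j) (r $ j))
      = (\<Prod>i\<in>UNIV. C i) * (\<Prod>j\<in>UNIV. gamma_weight (s' j) (r $ j))" for r :: "real^'n" and C :: "'m \<Rightarrow> real"
  proof -
    have "(\<Prod>i\<in>(UNIV::'m set). (r $ l) ^ (a i + 1)) = (r $ l) ^ (CARD('m) + sum a UNIV)"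
      by (simp add: power_sum[symmetric] sum.distrib prod.distrib power_add mult_ac)
    moreover have "(r $ l) ^ (CARD('m) + sum a UNIV) * (\<Prod>j\<in>UNIV. gamma_weight (s j) (r $ j))
        = (\<Prod>j\<in>UNIV. gamma_weight (s' j) (r $ j))"
      by (subst (1 2) prod.remove[of _ l])
        (auto simp: s'_def power_mult_gamma_weight mult.assoc[symmetric] intro!: arg_cong2[of _ _ _ _ "(*)"] prod.cong)
    ultimately show ?thesis by (simp only: prod.distrib) (simp add: mult_ac)
  qed
  have ix: "integrable lborel (\<lambda>x::real^'m. \<Prod>i\<in>UNIV. ?e c (a i) (x $ i))"
    and ex: "(\<integral>x. (\<Prod>i\<in>UNIV. ?e c (a i) ((x::real^'m) $ i)) \<partial>lborel) = (\<Prod>i\<in>UNIV. c ^ (a i + 1) * gauss_moment (a i))"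
    and ax: "(\<integral>x. (\<Prod>i\<in>UNIV. \<bar>?e c (a i) ((x::real^'m) $ i)\<bar>) \<partial>lborel)
        = (\<Prod>i\<in>UNIV. c ^ (a i + 1) * (\<integral>s. \<bar>s ^ a i * exp (- s\<^sup>2)\<bar> \<partial>lborel))" if "c > 0" for c :: real
    using integrable_lborel_vec_prod[of "\<lambda>i. ?e c (a i)", OF integrable_gauss_scaled[OF that]]
      integral_lborel_vec_prod[of "\<lambda>i. ?e c (a i)", OF integrable_gauss_scaled[OF that]]
      integral_lborel_vec_prod[of "\<lambda>i s. \<bar>?e c (a i) s\<bar>", OF integrable_abs[OF integrable_gauss_scaled[OF that]]]
    by (simp_all only: integral_gauss_scaled[OF that] integral_gauss_scaled_abs[OF that])
  \<comment> \<open>The Gaussian in \<open>x\<close> degenerates for \<open>r $ l \<le> 0\<close>, but there the Gamma weight vanishes.\<close>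
  have z: "(\<Prod>j\<in>UNIV. gamma_weight (\<sigma> j) (r $ j)) = 0" if "\<not> r $ l > 0" for r :: "real^'n" and \<sigma>
    using that by (intro prod_zero) (auto simp: gamma_weight_def intro!: bexI[of _ l])
  have inner_int: "integrable lborel (\<lambda>x. f (r, x))" for r
    using ix[of "r $ l"] z[of r] by (cases "r $ l > 0") (auto simp: f_def F_def)
  have inner: "(\<integral>x. f (r, x) \<partial>lborel) = (\<Prod>i\<in>UNIV. gauss_moment (a i)) * (\<Prod>j\<in>UNIV. gamma_weight (s' j) (r $ j))" for r
  proof (cases "r $ l > 0")
    case True
    have "(\<integral>x. f (r, x) \<partial>lborel) = (\<integral>x. (\<Prod>i\<in>UNIV. ?e (r $ l) (a i) ((x::real^'m) $ i)) \<partial>lborel)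
        * (\<Prod>j\<in>UNIV. gamma_weight (s j) (r $ j))"
      unfolding f_def F_def split fst_conv snd_conv by (rule integral_mult_left_zero)
    then show ?thesis by (simp only: ex[OF True] gw)
  qed (simp add: f_def F_def z del: prod_zero_iff)
  have inner_abs: "(\<integral>x. norm (f (r, x)) \<partial>lborel) =
      (\<Prod>i\<in>UNIV. \<integral>s. \<bar>s ^ a i * exp (- s\<^sup>2)\<bar> \<partial>lborel) * (\<Prod>j\<in>UNIV. gamma_weight (s' j) (r $ j))" for r
  proof (cases "r $ l > 0")
    case True
    have "(\<integral>x. norm (f (r, x)) \<partial>lborel) = (\<integral>x. (\<Prod>i\<in>UNIV. \<bar>?e (r $ l) (a i) ((x::real^'m) $ i)\<bar>)
        * (\<Prod>j\<in>UNIV. gamma_weight (s j) (r $ j)) \<partial>lborel)"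
      unfolding f_def F_def split fst_conv snd_conv real_norm_def abs_mult[of "prod _ _"] abs_prod
        abs_of_nonneg[OF gamma_weight_nonneg] ..
    also have "\<dots> = (\<integral>x. (\<Prod>i\<in>UNIV. \<bar>?e (r $ l) (a i) ((x::real^'m) $ i)\<bar>) \<partial>lborel)
        * (\<Prod>j\<in>UNIV. gamma_weight (s j) (r $ j))" by (rule integral_mult_left_zero)
    finally show ?thesis by (simp only: ax[OF True] gw)
  qed (simp add: f_def F_def z del: prod_zero_iff)
  have hg: "has_bochner_integral lborel (gamma_weight (s' j)) (Gamma (s' j))" for j
    by (rule has_bochner_integral_gamma_weight[OF s'])
  have ir: "integrable lborel (\<lambda>r::real^'n. \<Prod>j\<in>UNIV. gamma_weight (s' j) (r $ j))"
    and er: "(\<integral>r. (\<Prod>j\<in>UNIV. gamma_weight (s' j) ((r::real^'n) $ j)) \<partial>lborel) = (\<Prod>j\<in>UNIV. Gamma (s' j))"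
    using integrable_lborel_vec_prod[of "\<lambda>j. gamma_weight (s' j)"]
      integral_lborel_vec_prod[of "\<lambda>j. gamma_weight (s' j)"] hg
    by (simp_all add: has_bochner_integral_iff)
  have fi: "integrable (lborel \<Otimes>\<^sub>M lborel) f"
    by (rule lborel_pair.Fubini_integrable) (simp_all only: inner_abs inner_int AE_I2, simp_all add: ir)
  have fe: "integral\<^sup>L (lborel \<Otimes>\<^sub>M lborel) f = (\<Prod>i\<in>UNIV. gauss_moment (a i)) * (\<Prod>j\<in>UNIV. Gamma (s' j))"
    using lborel_pair.integral_fst'[OF fi] by (simp add: inner er)
  have F: "F = (\<lambda>(x, r). f (r, x))" by (auto simp: f_def)
  show ?I unfolding F lborel_prod[symmetric] using lborel_pair.integrable_product_swap[OF fi] .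
  show ?E unfolding F lborel_prod[symmetric]
    using lborel_pair.integral_product_swap[of f] fe by simp
qed

section \<open>The weight and its moments\<close>

locale sigma_weight =
  fixes l :: "'n::finite" and \<kappa> :: "real^'n"
  assumes \<kappa>: "\<And>j. \<kappa> $ j > -1"

begin

text \<open>
  The weight divided by \<open>|y|\<close> and extended by zero, see \<open>weight_eq\<close>: the exponent of \<open>|y|\<close> is \<open>\<kappa>\<^sub>l - 1\<close>, and the parameter
  of \<open>gamma_weight\<close> is one more than the exponent. Although \<open>\<kappa>\<^sub>l\<close> may be negative, the Gaussian in \<open>x / |y|\<close>
  contributes \<open>CARD('m) \<ge> 1\<close> to it, which makes all polynomials integrable.
\<close>

definition reduced_weight :: "('m::finite, 'n) point \<Rightarrow> real" where
  "reduced_weight z = (\<Prod>j\<in>UNIV. gamma_weight (if j = l then \<kappa> $ l else \<kappa> $ j + 1) (shear_coord l j z))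
     * exp (- ((norm (fst z))\<^sup>2 / (ysum (snd z))\<^sup>2))"

definition J :: "(('m::finite, 'n) point \<Rightarrow> real) \<Rightarrow> real" where
  "J f = (\<integral>z. f z * reduced_weight z \<partial>lborel)"

text \<open>
  The value of \<open>J\<close> on shear monomials, see \<open>J_shear_mon\<close>.
\<close>

definition shear_moment :: "('m::finite \<Rightarrow> nat) \<Rightarrow> ('n \<Rightarrow> nat) \<Rightarrow> real" where
  "shear_moment a b = (\<Prod>i\<in>UNIV. gauss_moment (a i)) *
    (\<Prod>j\<in>UNIV. Gamma (\<kappa> $ j + real (b j) + (if j = l then real (CARD('m) + sum a UNIV) else 1)))"

lemma weight_eq:
  "indicator (dom_RSigma l) z * weight_RSigma l \<kappa> z = ysum (snd z) * reduced_weight (z :: ('m::finite, 'n) point)"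
proof (cases "\<forall>j. shear_coord l j z > 0")
  case True
  obtain x y where z: "z = (x, y)" by fastforce
  have t: "ysum y > 0" using True[rule_format, of l] by (simp add: z shear_coord_def)
  have y: "y $ j > 0" if "j \<noteq> l" for j using True[rule_format, of j] that by (simp add: z shear_coord_def)
  have "z \<in> dom_RSigma l" using t y by (auto simp: z dom_RSigma_def R_Sigma_def less_imp_le)
  moreover have "(\<Prod>j\<in>UNIV. gamma_weight (if j = l then \<kappa> $ l else \<kappa> $ j + 1) (shear_coord l j z))
      = gamma_weight (\<kappa> $ l) (ysum y) * (\<Prod>j\<in>UNIV - {l}. gamma_weight (\<kappa> $ j + 1) (y $ j))"
    by (subst prod.remove[of _ l]) (auto simp: z shear_coord_def intro!: prod.cong)
  moreover have "(\<Prod>j\<in>UNIV - {l}. gamma_weight (\<kappa> $ j + 1) (y $ j)) =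
      (\<Prod>j\<in>UNIV - {l}. (y $ j) powr (\<kappa> $ j)) * exp (- ysum' l y)"
    using y by (auto simp: gamma_weight_def ysum'_def exp_sum sum_negf[symmetric] prod.distrib[symmetric] intro!: prod.cong)
  moreover have "ysum y * gamma_weight (\<kappa> $ l) (ysum y) = ysum y powr (\<kappa> $ l) * exp (- ysum y)"
    using power_mult_gamma_weight[of "ysum y" 1 "\<kappa> $ l"] t by (simp add: gamma_weight_def)
  ultimately show ?thesis
    by (simp add: reduced_weight_def weight_RSigma_def z exp_diff exp_minus field_simps)
next
  case False
  then obtain j where j: "shear_coord l j z \<le> 0" by (auto simp: not_less)
  obtain x y where z: "z = (x, y)" by fastforce
  have "(\<Prod>j\<in>UNIV. gamma_weight (if j = l then \<kappa> $ l else \<kappa> $ j + 1) (shear_coord l j z)) = 0"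
    using j by (intro prod_zero) (auto simp: gamma_weight_def intro!: exI[of _ j])
  then have "reduced_weight z = 0" by (simp add: reduced_weight_def)
  \<comment> \<open>On the boundary of the domain the weight is \<open>0\<close> because \<open>0 powr a = 0\<close> for every \<open>a\<close>.\<close>
  moreover have "weight_RSigma l \<kappa> z = 0" if "z \<in> dom_RSigma l"
  proof (cases "j = l")
    case True
    with j that have "ysum y = 0" by (auto simp: z shear_coord_def dom_RSigma_def R_Sigma_def)
    then show ?thesis by (simp add: z weight_RSigma_def)
  next
    case False
    with j that have "y $ j = 0" by (force simp: z shear_coord_def dom_RSigma_def R_Sigma_def)
    then have "(\<Prod>j\<in>UNIV - {l}. (y $ j) powr (\<kappa> $ j)) = 0"
      using False by (intro prod_zero) (auto intro!: bexI[of _ j])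
    then show ?thesis by (simp add: z weight_RSigma_def)
  qed
  ultimately show ?thesis by (auto simp: indicator_def)
qed

lemma
  fixes a :: "'m::finite \<Rightarrow> nat" and b :: "'n \<Rightarrow> nat"
  shows integrable_shear_mon: "integrable lborel (\<lambda>z. shear_mon l a b z * reduced_weight z)" (is ?I)
    and J_shear_mon: "J (shear_mon l a b) = shear_moment a b" (is ?E)
proof -
  define s where "s j = (if j = l then \<kappa> $ l else \<kappa> $ j + 1) + real (b j)" for j
  define F where "F z = (\<Prod>i\<in>UNIV. (fst z $ i) ^ a i * exp (- ((fst z $ i)\<^sup>2 / (snd z $ l)\<^sup>2)))
      * (\<Prod>j\<in>UNIV. gamma_weight (s j) (snd z $ j))" for z :: "('m, 'n) point"
  define \<phi> where "\<phi> z = (\<Sum>j\<in>UNIV - {l}. snd z $ j)" for z :: "('m, 'n) point"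
  define b0 :: "('m, 'n) point" where "b0 = (0, axis l 1)"
  have s': "0 < (s(l := s l + real (CARD('m) + sum a UNIV))) j" for j
  proof -
    have "1 \<le> CARD('m)" by (simp add: Suc_le_eq)
    then have "1 \<le> real (CARD('m) + sum a UNIV)" by linarith
    then show ?thesis using \<kappa>[of j] by (auto simp: s_def)
  qed
  have b0: "b0 \<in> Basis" by (auto simp: b0_def Basis_prod_def Basis_vec_def)
  have \<phi> [measurable]: "\<phi> \<in> borel_measurable borel"
    unfolding \<phi>_def[abs_def] by (intro borel_measurable_continuous_onI continuous_intros)
  \<comment> \<open>The shear \<open>y\<^sub>l \<mapsto> y\<^sub>l + \<Sum>\<^bsub>j \<noteq> l\<^esub> y\<^sub>j\<close> turns the coordinate \<open>l\<close> into \<open>ysum\<close>.\<close>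
  have distr: "distr lborel borel (\<lambda>z. z + \<phi> z *\<^sub>R b0) = lborel"
    by (rule distr_lborel_shear[OF b0 \<phi>]) (auto simp: \<phi>_def b0_def axis_def)
  have sh: "snd (z + \<phi> z *\<^sub>R b0) $ j = shear_coord l j z" for z j
    by (auto simp: shear_coord_def b0_def axis_def \<phi>_def ysum_def sum.remove[of UNIV l])
  have fst_sh: "fst (z + \<phi> z *\<^sub>R b0) = fst z" for z by (simp add: b0_def)
  have FF: "shear_mon l a b z * reduced_weight z = F (z + \<phi> z *\<^sub>R b0)" for z
  proof -
    have "exp (- ((norm (fst z))\<^sup>2 / c\<^sup>2)) = (\<Prod>i\<in>UNIV. exp (- ((fst z $ i)\<^sup>2 / c\<^sup>2)))" for c
      by (simp add: exp_sum[symmetric] sum_negf sum_divide_distrib[symmetric] norm_vec_def L2_set_def sum_nonneg)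
    moreover have "shear_coord l j z ^ b j * gamma_weight (if j = l then \<kappa> $ l else \<kappa> $ j + 1) (shear_coord l j z)
        = gamma_weight (s j) (shear_coord l j z)" for j
      by (simp add: power_mult_gamma_weight s_def)
    then have "(\<Prod>j\<in>UNIV. shear_coord l j z ^ b j) *
        (\<Prod>j\<in>UNIV. gamma_weight (if j = l then \<kappa> $ l else \<kappa> $ j + 1) (shear_coord l j z))
        = (\<Prod>j\<in>UNIV. gamma_weight (s j) (shear_coord l j z))"
      by (simp add: prod.distrib[symmetric])
    moreover have "shear_coord l l z = ysum (snd z)" by (simp add: shear_coord_def)
    ultimately show ?thesis
      unfolding F_def sh fst_sh shear_mon_def reduced_weight_def by (simp add: prod.distrib mult_ac)
  qed
  have FI: "integrable lborel F" and FE: "integral\<^sup>L lborel F = shear_moment a b"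
    using integrable_gauss_gamma[OF s', folded F_def[abs_def]] integral_gauss_gamma[OF s', folded F_def[abs_def]]
    by (auto simp: shear_moment_def s_def add_ac intro!: arg_cong2[of _ _ _ _ "(*)"] prod.cong arg_cong[of _ _ Gamma])
  have Fm [measurable]: "F \<in> borel_measurable borel" using FI by (auto dest: borel_measurable_integrable)
  have "integrable (distr lborel borel (\<lambda>z. z + \<phi> z *\<^sub>R b0)) F" using FI distr by simp
  then show ?I unfolding FF by (subst (asm) integrable_distr_eq) auto
  have "integral\<^sup>L (distr lborel borel (\<lambda>z. z + \<phi> z *\<^sub>R b0)) F = shear_moment a b" using FE distr by simp
  then show ?E unfolding J_def FF by (subst (asm) integral_distr) auto
qed

lemma integrable_polys: "f \<in> polys \<Longrightarrow> integrable lborel (\<lambda>z. f z * reduced_weight z)"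
proof (induction rule: polys_shear_mon_induct[where l = l])
  case (shear_mon c a b)
  show ?case using integrable_mult_right[OF integrable_shear_mon[of a b], of c] by (simp add: mult.assoc)
next
  case (add f g)
  then show ?case by (simp add: distrib_right)
qed

lemma J_add: "f \<in> polys \<Longrightarrow> g \<in> polys \<Longrightarrow> J (\<lambda>z. f z + g z) = J f + J g"
  by (simp add: J_def distrib_right integrable_polys)

lemma J_diff: "f \<in> polys \<Longrightarrow> g \<in> polys \<Longrightarrow> J (\<lambda>z. f z - g z) = J f - J g"
  by (simp add: J_def left_diff_distrib integrable_polys)

lemma J_scale: "J (\<lambda>z. c * f z) = c * J f"
  by (simp add: J_def mult.assoc)

lemma J_sum: "(\<And>i. i \<in> I \<Longrightarrow> f i \<in> polys) \<Longrightarrow> J (\<lambda>z. \<Sum>i\<in>I. f i z) = (\<Sum>i\<in>I. J (f i))"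
  by (simp add: J_def sum_distrib_right integrable_polys)

lemma Gamma_plus1_pos: "s > 0 \<Longrightarrow> Gamma (s + 1) = s * Gamma (s::real)"
  by (rule Gamma_plus1) (auto elim!: nonpos_Ints_cases)

lemma shear_moment_Suc_l:
  fixes a :: "'m::finite \<Rightarrow> nat"
  shows "shear_moment a (b(l := Suc (b l))) = (\<kappa> $ l + real (b l) + real (CARD('m) + sum a UNIV)) * shear_moment a b"
proof -
  have "1 \<le> CARD('m)" by (simp add: Suc_le_eq)
  then have "1 \<le> real (CARD('m) + sum a UNIV)" by linarith
  then have "\<kappa> $ l + real (b l) + real (CARD('m) + sum a UNIV) > 0" using \<kappa>[of l] by linarith
  from Gamma_plus1_pos[OF this] show ?thesis
    unfolding shear_moment_def mult.left_commute[of "_ + _"]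
    by (intro arg_cong2[of _ _ _ _ "(*)"] refl prod_change_one[of _ l]) (auto simp: add_ac)
qed

lemma shear_moment_Suc:
  fixes a :: "'m::finite \<Rightarrow> nat"
  assumes "j \<noteq> l"
  shows "shear_moment a (b(j := Suc (b j))) = (\<kappa> $ j + real (b j) + 1) * shear_moment a b"
proof -
  have "\<kappa> $ j + real (b j) + 1 > 0" using \<kappa>[of j] by linarith
  from Gamma_plus1_pos[OF this] show ?thesis
    unfolding shear_moment_def mult.left_commute[of "_ + _"] using assms
    by (intro arg_cong2[of _ _ _ _ "(*)"] refl prod_change_one[of _ j]) (auto simp: add_ac)
qed

lemma shear_moment_Suc_Suc:
  fixes a :: "'m::finite \<Rightarrow> nat"
  shows "shear_moment (a(i := a i + 2)) b = (real (a i) + 1) / 2 * shear_moment a (b(l := b l + 2))"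
proof -
  have "sum (a(i := a i + 2)) UNIV = sum a UNIV + 2"
    by (subst (1 2) sum.remove[of _ i]) auto
  then have "(\<Prod>j\<in>UNIV. Gamma (\<kappa> $ j + real (b j) + (if j = l then real (CARD('m) + sum (a(i := a i + 2)) UNIV) else 1)))
    = (\<Prod>j\<in>UNIV. Gamma (\<kappa> $ j + real ((b(l := b l + 2)) j) + (if j = l then real (CARD('m) + sum a UNIV) else 1)))"
    by (intro prod.cong arg_cong[of _ _ Gamma]) auto
  moreover have "(\<Prod>k\<in>UNIV. gauss_moment ((a(i := a i + 2)) k)) = (real (a i) + 1) / 2 * (\<Prod>k\<in>UNIV. gauss_moment (a k))"
    by (rule prod_change_one[of _ i]) (auto simp: gauss_moment_Suc_Suc[simplified])
  ultimately show ?thesis by (simp only: shear_moment_def mult.assoc)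
qed

lemma shear_moment_one: "a i = 1 \<Longrightarrow> shear_moment a b = 0"
proof -
  assume "a i = 1"
  then have "(\<Prod>i\<in>UNIV. gauss_moment (a i)) = 0"
    using gauss_moment_1 by (intro prod_zero) (auto intro!: exI[of _ i])
  then show ?thesis by (simp add: shear_moment_def)
qed

section \<open>Integration by parts\<close>

text \<open>
  Integration by parts in \<open>t = |y|\<close> along the rays \<open>x = t s\<close>, where \<open>J\<close> has the density
  \<open>t powr (\<alpha> - 1) * exp (- t)\<close> with \<open>\<alpha> = \<kappa>\<^sub>l + CARD('m)\<close>. On monomials, which are eigenfunctions of \<open>cone_dil\<close>, it is the
  functional equation of Gamma.
\<close>

lemma J_cone_dil:
  fixes f :: "('m::finite, 'n) point \<Rightarrow> real"
  assumes "f \<in> polys"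
  shows "J (\<lambda>z. cone_dil l f z + (\<kappa> $ l + real CARD('m) - ysum (snd z)) * f z) = 0"
  using assms
proof (induction rule: polys_shear_mon_induct[where l = l])
  case (shear_mon c a b)
  define C where "C = real (sum a UNIV) + real (b l) + \<kappa> $ l + real CARD('m)"
  have "cone_dil l (\<lambda>z. c * shear_mon l a b z) z + (\<kappa> $ l + real CARD('m) - ysum (snd z)) * (c * shear_mon l a b z)
      = c * (C * shear_mon l a b z - shear_mon l a (b(l := Suc (b l))) z)" for z :: "('m, 'n) point"
    unfolding shear_mon_mult_shear_coord[symmetric]
    by (simp add: cone_dil_scale polys_shear_mon cone_dil_shear_mon C_def shear_coord_def algebra_simps)
  moreover have "J (\<lambda>z. c * (C * shear_mon l a b z - shear_mon l a (b(l := Suc (b l))) z)) = 0"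
    by (simp only: J_scale J_diff polys_shear_mon polys_scale J_shear_mon shear_moment_Suc_l) (simp add: C_def algebra_simps)
  ultimately show ?case by presburger
next
  case (add f g)
  have "J (\<lambda>z. (cone_dil l f z + (\<kappa> $ l + real CARD('m) - ysum (snd z)) * f z)
      + (cone_dil l g z + (\<kappa> $ l + real CARD('m) - ysum (snd z)) * g z)) = 0"
    by (subst J_add) (auto intro!: polys_intros polys_cone_dil simp: add)
  then show ?case using add.hyps by (simp add: cone_dil_add algebra_simps)
qed

text \<open>
  Integration by parts against \<open>y\<^sub>j powr \<kappa>\<^sub>j * exp (- y\<^sub>j)\<close> with \<open>|y|\<close> fixed, again the functional equation of
  Gamma on monomials.
\<close>

lemma J_shear_deriv:
  fixes f :: "('m::finite, 'n) point \<Rightarrow> real"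
  assumes f: "f \<in> polys" and j: "j \<noteq> l"
  shows "J (\<lambda>z. snd z $ j * shear_deriv l j f z + (\<kappa> $ j + 1 - snd z $ j) * f z) = 0"
  using f
proof (induction rule: polys_shear_mon_induct[where l = l])
  case (shear_mon c a b)
  define C where "C = \<kappa> $ j + real (b j) + 1"
  have "snd z $ j * shear_deriv l j (\<lambda>z. c * shear_mon l a b z) z + (\<kappa> $ j + 1 - snd z $ j) * (c * shear_mon l a b z)
      = c * (C * shear_mon l a b z - shear_mon l a (b(j := Suc (b j))) z)" for z :: "('m, 'n) point"
    using shear_deriv_shear_mon[OF j, of z a b] j unfolding shear_mon_mult_shear_coord[symmetric]
    by (simp add: shear_deriv_def dir_deriv_scale polys_shear_mon C_def shear_coord_def algebra_simps)
  moreover have "J (\<lambda>z. c * (C * shear_mon l a b z - shear_mon l a (b(j := Suc (b j))) z)) = 0"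
    by (simp only: J_scale J_diff polys_shear_mon polys_scale J_shear_mon shear_moment_Suc[OF j]) (simp add: C_def algebra_simps)
  ultimately show ?case by presburger
next
  case (add f g)
  have "J (\<lambda>z. (snd z $ j * shear_deriv l j f z + (\<kappa> $ j + 1 - snd z $ j) * f z)
      + (snd z $ j * shear_deriv l j g z + (\<kappa> $ j + 1 - snd z $ j) * g z)) = 0"
    by (subst J_add) (auto intro!: polys_intros polys_shear_deriv simp: add)
  then show ?case using add.hyps by (simp add: shear_deriv_def dir_deriv_add algebra_simps)
qed

text \<open>
  Integration by parts against \<open>exp (- x\<^sub>i\<^sup>2 / |y|\<^sup>2)\<close>, multiplied by \<open>|y|\<^sup>2 / 2\<close> so that the integrand stays
  polynomial. On monomials it is the recursion of the Gaussian moments.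
\<close>

lemma J_dx:
  fixes f :: "('m::finite, 'n) point \<Rightarrow> real"
  assumes f: "f \<in> polys"
  shows "J (\<lambda>z. (ysum (snd z))\<^sup>2 / 2 * dx i f z - fst z $ i * f z) = 0"
  using f
proof (induction rule: polys_shear_mon_induct[where l = l])
  case (shear_mon c a b)
  show ?case
  proof (cases "a i")
    case 0
    \<comment> \<open>The derivative vanishes, and the remaining moment is odd in \<open>x\<^sub>i\<close>.\<close>
    then have "(ysum (snd z))\<^sup>2 / 2 * dx i (\<lambda>z. c * shear_mon l a b z) z - fst z $ i * (c * shear_mon l a b z)
        = (- c) * shear_mon l (a(i := Suc (a i))) b z" for z :: "('m, 'n) point"
      unfolding shear_mon_mult_fst[symmetric]
      by (simp add: dx_eq_dir_deriv dir_deriv_scale polys_shear_mon) (simp add: dx_eq_dir_deriv[symmetric] dx_shear_mon_0)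
    moreover have "J (\<lambda>z::('m, 'n) point. (- c) * shear_mon l (a(i := Suc (a i))) b z) = 0"
      by (simp only: J_scale J_shear_mon) (simp add: shear_moment_one[of _ i] 0)
    ultimately show ?thesis by presburger
  next
    case (Suc k)
    \<comment> \<open>With \<open>a = a' + e\<^sub>i\<close> the claim compares the moments of \<open>t\<^sup>2\<close> and of \<open>x\<^sub>i\<^sup>2\<close> times the monomial of \<open>a'\<close>.\<close>
    define a' where "a' = a(i := k)"
    have a: "a = a'(i := Suc (a' i))" using Suc by (auto simp: a'_def)
    have dx: "dx i (\<lambda>z. c * shear_mon l a b z) z = c * ((real (a' i) + 1) * shear_mon l a' b z)" for z :: "('m, 'n) point"
      unfolding a using dx_shear_mon_Suc[of i l a' b] by (simp add: dx_eq_dir_deriv dir_deriv_scale polys_shear_mon)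
    have t2: "(ysum (snd z))\<^sup>2 * shear_mon l a' b z = shear_mon l a' (b(l := b l + 2)) z" for z :: "('m, 'n) point"
      using shear_mon_mult_shear_coord[of l l z a' b] shear_mon_mult_shear_coord[of l l z a' "b(l := Suc (b l))"]
      by (simp add: shear_coord_def power2_eq_square mult.assoc)
    have x2: "fst z $ i * shear_mon l a b z = shear_mon l (a'(i := a' i + 2)) b z" for z :: "('m, 'n) point"
      unfolding a shear_mon_mult_fst by simp
    have "(ysum (snd z))\<^sup>2 / 2 * dx i (\<lambda>z. c * shear_mon l a b z) z - fst z $ i * (c * shear_mon l a b z)
        = c * ((real (a' i) + 1) / 2 * shear_mon l a' (b(l := b l + 2)) z - shear_mon l (a'(i := a' i + 2)) b z)" for z :: "('m, 'n) point"
      unfolding dx t2[symmetric] x2[symmetric] by (simp add: field_simps)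
    moreover have "J (\<lambda>z::('m, 'n) point. c * ((real (a' i) + 1) / 2 * shear_mon l a' (b(l := b l + 2)) z - shear_mon l (a'(i := a' i + 2)) b z)) = 0"
      by (simp only: J_scale J_diff polys_shear_mon polys_scale J_shear_mon shear_moment_Suc_Suc) simp
    ultimately show ?thesis by presburger
  qed
next
  case (add f g)
  have "J (\<lambda>z. ((ysum (snd z))\<^sup>2 / 2 * dx i f z - fst z $ i * f z)
      + ((ysum (snd z))\<^sup>2 / 2 * dx i g z - fst z $ i * g z)) = 0"
  proof -
    have "(\<lambda>z. (ysum (snd z))\<^sup>2 / 2 * dx i h z - fst z $ i * h z) \<in> polys" if "h \<in> polys" for h :: "('m, 'n) point \<Rightarrow> real"
      by (intro polys_diff polys_mult polys_half_square polys_fst polys_dx that)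
    from J_add[OF this[OF add.hyps(1)] this[OF add.hyps(2)]] show ?thesis by (simp only: add.IH)
  qed
  then show ?case using add.hyps by (simp add: dx_eq_dir_deriv dir_deriv_add algebra_simps add_divide_distrib)
qed

section \<open>Symmetry of the operator\<close>

lemma J_cone_dil_parts:
  fixes u v :: "('m::finite, 'n) point \<Rightarrow> real"
  assumes u: "u \<in> polys" and v: "v \<in> polys"
  shows "J (\<lambda>z. v z * (cone_dil l (cone_dil l u) z + (\<kappa> $ l + real CARD('m) - ysum (snd z)) * cone_dil l u z))
    = - J (\<lambda>z. cone_dil l v z * cone_dil l u z)"
proof -
  note P = u v polys_cone_dil
  \<comment> \<open>\<open>J_cone_dil\<close> for the product \<open>v * T u\<close>.\<close>
  have "0 = J (\<lambda>z. cone_dil l (\<lambda>z. v z * cone_dil l u z) z + (\<kappa> $ l + real CARD('m) - ysum (snd z)) * (v z * cone_dil l u z))"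
    by (rule J_cone_dil[symmetric]) (intro polys_mult P)
  also have "\<dots> = J (\<lambda>z. cone_dil l v z * cone_dil l u z
      + v z * (cone_dil l (cone_dil l u) z + (\<kappa> $ l + real CARD('m) - ysum (snd z)) * cone_dil l u z))"
    by (simp add: derivation_mult[OF derivation_cone_dil v polys_cone_dil[OF u]] algebra_simps)
  also have "\<dots> = J (\<lambda>z. cone_dil l v z * cone_dil l u z)
      + J (\<lambda>z. v z * (cone_dil l (cone_dil l u) z + (\<kappa> $ l + real CARD('m) - ysum (snd z)) * cone_dil l u z))"
    by (rule J_add) (intro polys_intros P)+
  finally show ?thesis by simp
qed

text \<open>
  The Dirichlet form of the Hermite operator: each summand of \<open>H u\<close> is \<open>J_dx\<close> applied to \<open>v * \<partial>\<^sub>i u\<close>.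
\<close>

lemma J_hermite_op_parts:
  fixes u v :: "('m::finite, 'n) point \<Rightarrow> real"
  assumes u: "u \<in> polys" and v: "v \<in> polys"
  shows "J (\<lambda>z. v z * hermite_op u z) = - (\<Sum>i\<in>UNIV. J (\<lambda>z. (ysum (snd z))\<^sup>2 / 2 * (dx i v z * dx i u z)))"
proof -
  note P = u v polys_dx polys_half_square polys_mult polys_diff polys_fst
  have "0 = J (\<lambda>z. (ysum (snd z))\<^sup>2 / 2 * dx i (\<lambda>z. v z * dx i u z) z - fst z $ i * (v z * dx i u z))" for i
    by (rule J_dx[symmetric]) (intro P)
  also have "\<dots> i = J (\<lambda>z. (ysum (snd z))\<^sup>2 / 2 * (dx i v z * dx i u z)
      + v z * ((ysum (snd z))\<^sup>2 / 2 * dx i (dx i u) z - fst z $ i * dx i u z))" for i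
    using u v by (simp add: dx_eq_dir_deriv dir_deriv_mult polys_dir_deriv algebra_simps add_divide_distrib)
  also have "\<dots> i = J (\<lambda>z. (ysum (snd z))\<^sup>2 / 2 * (dx i v z * dx i u z))
      + J (\<lambda>z. v z * ((ysum (snd z))\<^sup>2 / 2 * dx i (dx i u) z - fst z $ i * dx i u z))" for i
    by (rule J_add) (intro P)+
  finally have *: "J (\<lambda>z. v z * ((ysum (snd z))\<^sup>2 / 2 * dx i (dx i u) z - fst z $ i * dx i u z))
      = - J (\<lambda>z. (ysum (snd z))\<^sup>2 / 2 * (dx i v z * dx i u z))" for i by (simp add: eq_neg_iff_add_eq_0 add.commute)
  have "J (\<lambda>z. v z * hermite_op u z)
      = J (\<lambda>z. \<Sum>i\<in>UNIV. v z * ((ysum (snd z))\<^sup>2 / 2 * dx i (dx i u) z - fst z $ i * dx i u z))"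
    by (simp add: hermite_op_def laplace_x_def euler_x_def sum_distrib_left sum_subtractf right_diff_distrib)
  also have "\<dots> = (\<Sum>i\<in>UNIV. J (\<lambda>z. v z * ((ysum (snd z))\<^sup>2 / 2 * dx i (dx i u) z - fst z $ i * dx i u z)))"
    by (rule J_sum) (intro P)
  finally show ?thesis unfolding * sum_negf .
qed

lemma J_hermite_op_sym: "u \<in> polys \<Longrightarrow> v \<in> polys \<Longrightarrow> J (\<lambda>z. v z * hermite_op u z) = J (\<lambda>z. u z * hermite_op v z)"
  by (simp add: J_hermite_op_parts mult.commute[of "dx _ u _"])

text \<open>
  \<open>J_shear_deriv\<close> for \<open>|y| v \<partial>u\<close>; the factor \<open>|y|\<close> is constant for the derivative in question.
\<close>

lemma J_shear_deriv_parts: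
  fixes u v :: "('m::finite, 'n) point \<Rightarrow> real"
  assumes u: "u \<in> polys" and v: "v \<in> polys" and j: "j \<noteq> l"
  shows "J (\<lambda>z. v z * (ysum (snd z) * (snd z $ j * shear_deriv l j (shear_deriv l j u) z + (\<kappa> $ j + 1 - snd z $ j) * shear_deriv l j u z)))
    = - J (\<lambda>z. ysum (snd z) * snd z $ j * (shear_deriv l j v z * shear_deriv l j u z))"
proof -
  note P = u v polys_shear_deriv
  have d: "shear_deriv l j (\<lambda>z. ysum (snd z) * v z * shear_deriv l j u z) =
      (\<lambda>z. ysum (snd z) * (shear_deriv l j v z * shear_deriv l j u z) + ysum (snd z) * v z * shear_deriv l j (shear_deriv l j u) z)"
  proof -
    have "shear_deriv l j (\<lambda>z. ysum (snd z) * v z * shear_deriv l j u z)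
        = (\<lambda>z. (shear_deriv l j (\<lambda>z. ysum (snd z)) z * v z + ysum (snd z) * shear_deriv l j v z) * shear_deriv l j u z
            + ysum (snd z) * v z * shear_deriv l j (shear_deriv l j u) z)"
      using u v by (simp add: shear_deriv_def dir_deriv_mult polys_mult polys_ysum polys_dir_deriv)
    then show ?thesis by (simp add: shear_deriv_ysum mult.assoc)
  qed
  have "0 = J (\<lambda>z. snd z $ j * shear_deriv l j (\<lambda>z. ysum (snd z) * v z * shear_deriv l j u z) z
      + (\<kappa> $ j + 1 - snd z $ j) * (ysum (snd z) * v z * shear_deriv l j u z))"
    by (rule J_shear_deriv[symmetric, OF _ j]) (intro polys_mult polys_ysum P)
  also have "\<dots> = J (\<lambda>z. ysum (snd z) * snd z $ j * (shear_deriv l j v z * shear_deriv l j u z)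
      + v z * (ysum (snd z) * (snd z $ j * shear_deriv l j (shear_deriv l j u) z + (\<kappa> $ j + 1 - snd z $ j) * shear_deriv l j u z)))"
    unfolding d by (simp add: algebra_simps)
  also have "\<dots> = J (\<lambda>z. ysum (snd z) * snd z $ j * (shear_deriv l j v z * shear_deriv l j u z))
      + J (\<lambda>z. v z * (ysum (snd z) * (snd z $ j * shear_deriv l j (shear_deriv l j u) z + (\<kappa> $ j + 1 - snd z $ j) * shear_deriv l j u z)))"
    by (rule J_add) (intro polys_intros P)+
  finally show ?thesis by simp
qed

text \<open>
  Each of the three parts of \<open>D_RSigma_factorisation\<close> is integrated by parts separately; for \<open>H\<^sup>2\<close> one factor is
  moved to \<open>v\<close> by the symmetry of \<open>H\<close>. The resulting form is visibly symmetric in \<open>u\<close> and \<open>v\<close>, up to \<open>J_hermite_op_sym\<close>.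
\<close>

lemma J_D_RSigma_parts:
  fixes u v :: "('m::finite, 'n) point \<Rightarrow> real"
  assumes u: "u \<in> polys" and v: "v \<in> polys"
  shows "J (\<lambda>z. v z * (ysum (snd z) * D_RSigma l \<kappa> u z)) =
    - J (\<lambda>z. cone_dil l v z * cone_dil l u z) - J (\<lambda>z. hermite_op u z * hermite_op v z)
    + (\<kappa> $ l + real CARD('m)) * J (\<lambda>z. v z * hermite_op u z)
    - (\<Sum>j\<in>UNIV - {l}. J (\<lambda>z. ysum (snd z) * snd z $ j * (shear_deriv l j v z * shear_deriv l j u z)))"
proof -
  let ?\<alpha> = "\<kappa> $ l + real CARD('m)"
  let ?A = "\<lambda>z. v z * (cone_dil l (cone_dil l u) z + (?\<alpha> - ysum (snd z)) * cone_dil l u z)"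
  let ?B = "\<lambda>z. v z * hermite_op (hermite_op u) z"
  let ?C = "\<lambda>z. ?\<alpha> * (v z * hermite_op u z)"
  let ?G = "\<lambda>j z. v z * (ysum (snd z) * (snd z $ j * shear_deriv l j (shear_deriv l j u) z + (\<kappa> $ j + 1 - snd z $ j) * shear_deriv l j u z))"
  note P = u v polys_cone_dil polys_hermite_op polys_shear_deriv
  have PA: "?A \<in> polys" and PB: "?B \<in> polys" and PC: "?C \<in> polys" and PG: "?G j \<in> polys" for j
    by (intro polys_intros P)+
  have "v z * (ysum (snd z) * D_RSigma l \<kappa> u z) = ?A z - ?B z + ?C z + (\<Sum>j\<in>UNIV - {l}. ?G j z)" for z
    unfolding D_RSigma_factorisation[OF u] sum_distrib_left[symmetric] by (simp add: algebra_simps)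
  then have "J (\<lambda>z. v z * (ysum (snd z) * D_RSigma l \<kappa> u z)) = J (\<lambda>z. ?A z - ?B z + ?C z + (\<Sum>j\<in>UNIV - {l}. ?G j z))"
    by presburger
  also have "\<dots> = J ?A - J ?B + J ?C + (\<Sum>j\<in>UNIV - {l}. J (?G j))"
    by (simp only: J_add J_diff J_sum PA PB PC PG polys_add polys_diff polys_sum)
  also have "J ?B = J (\<lambda>z. hermite_op u z * hermite_op v z)" by (rule J_hermite_op_sym) (intro P)+
  also have "(\<Sum>j\<in>UNIV - {l}. J (?G j)) = (\<Sum>j\<in>UNIV - {l}. - J (\<lambda>z. ysum (snd z) * snd z $ j * (shear_deriv l j v z * shear_deriv l j u z)))"
    by (rule sum.cong) (simp_all add: J_shear_deriv_parts u v)
  finally show ?thesis by (simp only: J_cone_dil_parts[OF u v] J_scale sum_negf add_uminus_conv_diff)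
qed

lemma J_D_RSigma_sym:
  assumes u: "u \<in> polys" and v: "v \<in> polys"
  shows "J (\<lambda>z. v z * (ysum (snd z) * D_RSigma l \<kappa> u z)) = J (\<lambda>z. u z * (ysum (snd z) * D_RSigma l \<kappa> v z))"
  unfolding J_D_RSigma_parts[OF u v] J_D_RSigma_parts[OF v u] J_hermite_op_sym[OF u v]
  by (simp only: mult.commute)

section \<open>Positivity and orthogonality\<close>

lemma reduced_weight_nonneg: "0 \<le> ysum (snd z) * reduced_weight z"
proof (cases "ysum (snd z) > 0")
  case True
  then show ?thesis by (simp add: reduced_weight_def prod_nonneg gamma_weight_nonneg)
next
  case False
  then have "(\<Prod>j\<in>UNIV. gamma_weight (if j = l then \<kappa> $ l else \<kappa> $ j + 1) (shear_coord l j z)) = 0"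
    by (intro prod_zero) (auto simp: gamma_weight_def shear_coord_def intro!: exI[of _ l])
  then show ?thesis by (simp add: reduced_weight_def del: prod_zero_iff)
qed

text \<open>
  The full weight is positive on a nonempty open set, so a polynomial of square integral zero vanishes
  almost everywhere there, hence everywhere there by continuity.
\<close>

lemma polys_eq_0_if_J_square:
  fixes p :: "('m::finite, 'n) point \<Rightarrow> real"
  assumes p: "p \<in> polys" and J0: "J (\<lambda>z. ysum (snd z) * (p z * p z)) = 0"
  shows "p = (\<lambda>z. 0)"
proof -
  define U where "U = {z :: ('m, 'n) point. \<forall>j. 0 < shear_coord l j z}"
  have nn: "0 \<le> ysum (snd z) * (p z * p z) * reduced_weight z" for z
    using mult_nonneg_nonneg[OF reduced_weight_nonneg[of z] zero_le_square[of "p z"]] by (simp add: mult_ac)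
  have "integrable lborel (\<lambda>z. ysum (snd z) * (p z * p z) * reduced_weight z)"
    by (intro integrable_polys polys_intros p)
  then have AE: "AE z in lborel. ysum (snd z) * (p z * p z) * reduced_weight z = 0"
    using J0 nn unfolding J_def by (subst (asm) integral_nonneg_eq_0_iff_AE) auto
  have pos: "ysum (snd z) * reduced_weight z > 0" if "z \<in> U" for z
  proof -
    have "(\<Prod>j\<in>UNIV. gamma_weight (if j = l then \<kappa> $ l else \<kappa> $ j + 1) (shear_coord l j z)) > 0"
      using that by (intro prod_pos ballI gamma_weight_pos) (simp add: U_def)
    moreover have "ysum (snd z) > 0" using that by (auto simp: U_def shear_coord_def dest: spec[of _ l])
    ultimately show ?thesis by (simp add: reduced_weight_def)
  qed
  have "open U"
  proof -
    have "U = (\<Inter>j. {z. 0 < shear_coord l j z})" by (auto simp: U_def)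
    moreover have "open {z :: ('m, 'n) point. 0 < shear_coord l j z}" for j
      by (intro open_Collect_less continuous_on_const polys_continuous polys_shear_coord)
    ultimately show ?thesis by auto
  qed
  define N where "N = {z \<in> U. p z \<noteq> 0}"
  have "open N"
  proof -
    have "open {z. p z \<noteq> 0}" by (intro open_Collect_neq continuous_on_const polys_continuous p)
    with \<open>open U\<close> show ?thesis unfolding N_def Collect_conj_eq by auto
  qed
  moreover have "AE z in lborel. z \<notin> N"
    using AE
  proof eventually_elim
    case (elim z)
    then have "(ysum (snd z) * reduced_weight z) * (p z * p z) = 0" by (simp add: mult_ac)
    then show ?case using pos[of z] by (auto simp: N_def)
  qed
  then have "N \<in> null_sets lborel"
    using \<open>open N\<close> by (subst (asm) AE_iff_null_sets[symmetric]) auto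
  then have "negligible N" using null_sets_completionI negligible_iff_null_sets by blast
  ultimately have "N = {}" using open_not_negligible by blast
  then have "p z = 0" if "z \<in> U" for z using that unfolding N_def by blast
  moreover have "(0, \<chi> j. 1) \<in> U" by (auto simp: U_def shear_coord_def ysum_def)
  ultimately show ?thesis by (rule polys_eq_0_if_open[OF p \<open>open U\<close>, rotated])
qed

text \<open>
  Passage from degrees in the sense of \<open>poly_deg\<close> to degree bounds: \<open>q\<close> has some exact degree below \<open>n\<close>.
\<close>

lemma orth_polys_imp_J_eq_0:
  fixes u q :: "('m::finite, 'n) point \<Rightarrow> real"
  assumes u: "u \<in> orth_polys n (dom_RSigma l) (weight_RSigma l \<kappa>)" and q: "degree_le (int n - 1) q"
  shows "J (\<lambda>z. u z * (ysum (snd z) * q z)) = 0"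
proof (cases n)
  case 0
  \<comment> \<open>Here \<open>q\<close> has degree at most \<open>-1\<close>.\<close>
  then have "q = (\<lambda>z. 0)" using degree_le_neg[OF q] by simp
  then show ?thesis by (simp add: J_def)
next
  case (Suc k)
  then have "poly_deg_le k q" using degree_le_imp_poly_deg_le[OF q, of k] by simp
  define m where "m = (LEAST m. poly_deg_le m q)"
  have "poly_deg_le m q" "m \<le> k"
    unfolding m_def by (rule LeastI, fact) (rule Least_le, fact)
  moreover have "\<not> poly_deg_le i q" if "i < m" for i using that not_less_Least unfolding m_def by blast
  ultimately have "poly_deg q m" "m < n" using Suc by (auto simp: poly_deg_def)
  then have "(LINT z:dom_RSigma l|lborel. u z * q z * weight_RSigma l \<kappa> z) = 0"
    using u by (auto simp: orth_polys_def)
  moreover have "(LINT z:dom_RSigma l|lborel. u z * q z * weight_RSigma l \<kappa> z) = J (\<lambda>z. u z * (ysum (snd z) * q z))"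
    unfolding set_lebesgue_integral_def J_def
  proof (rule Bochner_Integration.integral_cong[OF refl])
    fix z :: "('m, 'n) point"
    have "indicator (dom_RSigma l) z *\<^sub>R (u z * q z * weight_RSigma l \<kappa> z)
        = u z * q z * (indicator (dom_RSigma l) z * weight_RSigma l \<kappa> z)" by simp
    then show "indicator (dom_RSigma l) z *\<^sub>R (u z * q z * weight_RSigma l \<kappa> z) = u z * (ysum (snd z) * q z) * reduced_weight z"
      unfolding weight_eq by simp
  qed
  ultimately show ?thesis by simp
qed

end

section \<open>The eigenvalue equation\<close>

theorem theorem6p3:
  fixes \<kappa> :: "real^'n::finite" and l :: 'n and n :: nat
    and u :: "(real^'m::finite) \<times> (real^'n) \<Rightarrow> real"
  assumes "\<forall>j. \<kappa> $ j > -1"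
    and "u \<in> orth_polys n (dom_RSigma l) (weight_RSigma l \<kappa>)"
  shows "D_RSigma l \<kappa> u = (\<lambda>z. - real n * u z)"
proof -
  interpret sigma_weight l \<kappa> by standard (use assms(1) in auto)
  have un: "degree_le (int n) u"
    using assms(2) poly_deg_le_imp_degree_le by (auto simp: orth_polys_def poly_deg_def degree_le_zero)
  define p where "p = (\<lambda>z. D_RSigma l \<kappa> u z + real n * u z)"
  have p: "degree_le (int n - 1) p" using degree_le_D_RSigma_plus[OF un] by (simp add: p_def)
  have P: "u \<in> polys" "p \<in> polys" "D_RSigma l \<kappa> u \<in> polys" using un p degree_le_D_RSigma degree_le_polys by blast+
  \<comment> \<open>The left-hand side is the weighted integral of \<open>p\<^sup>2\<close>: the factor \<open>ysum\<close> restores the full weight.\<close>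
  have "J (\<lambda>z. ysum (snd z) * (p z * p z))
      = J (\<lambda>z. p z * (ysum (snd z) * D_RSigma l \<kappa> u z) + real n * (u z * (ysum (snd z) * p z)))"
    by (intro arg_cong[of _ _ J] ext) (simp add: p_def algebra_simps)
  also have "\<dots> = J (\<lambda>z. p z * (ysum (snd z) * D_RSigma l \<kappa> u z)) + real n * J (\<lambda>z. u z * (ysum (snd z) * p z))"
    unfolding J_scale[symmetric] by (rule J_add) (intro polys_intros P)+
  also have "J (\<lambda>z. p z * (ysum (snd z) * D_RSigma l \<kappa> u z)) = J (\<lambda>z. u z * (ysum (snd z) * D_RSigma l \<kappa> p z))"
    by (rule J_D_RSigma_sym) (fact P)+
  also have "\<dots> = 0" by (rule orth_polys_imp_J_eq_0[OF assms(2) degree_le_D_RSigma[OF p]])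
  also have "J (\<lambda>z. u z * (ysum (snd z) * p z)) = 0" by (rule orth_polys_imp_J_eq_0[OF assms(2) p])
  finally have "p = (\<lambda>z. 0)" by (intro polys_eq_0_if_J_square P) simp
  then show ?thesis by (simp add: p_def fun_eq_iff add_eq_0_iff2)
qed

end
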